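(* Let $M$ be a smooth $n$-manifold, let $V=V(t)$, $t\in[0,T)$, be an arbitrary smooth one-parameter family of $1$-forms on $M$, and suppose the metrics $g(t)$ satisfy the modified Ricci flow $$\frac{\partial}{\partial t}g_{ij}=-2R_{ij}+\nabla_iV_j+\nabla_jV_i .$$ Let $\eta$ be an arbitrary smooth function on $\tilde M=M\times[0,T)$ and let $\tilde V=V+\eta\,dt$, i.e. $\tilde V_i=V_i$ for $i\ge1$ and $\tilde V_0=\eta$. Then the space-time metric $\tilde g$ and space-time connection $\tilde\nabla$ associated to $(g,V)$ satisfy, for all $0\le i,j,k\le n$, $$\frac{\partial}{\partial t}\tilde g^{ij}=\tilde g^{ik}\tilde g^{jl}\left(2\tilde R_{kl}-\tilde\nabla_k\tilde V_l-\tilde\nabla_l\tilde V_k\right),$$ $$\frac{\partial}{\partial t}\tilde\Gamma^k_{ij}=-\tilde\nabla_i\left(\tilde R^k_j-\tfrac12\tilde\nabla_j\tilde V^k-\tfrac12\tilde\nabla^k\tilde V_j\right)-\tilde\nabla_j\left(\tilde R^k_i-\tfrac12\tilde\nabla_i\tilde V^k-\tfrac12\tilde\nabla^k\tilde V_i\right)+\tilde\nabla^k\left(\tilde R_{ij}-\tfrac12\tilde\nabla_i\tilde V_j-\tfrac12\tilde\nabla_j\tilde V_i\right).$$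
   Context: Local coordinates on $\tilde M=M\times[0,T)$ are $(x^0,x^1,\dots,x^n)$, where $x^1,\dots,x^n$ are local coordinates on $M$ and $x^0=t$. $\nabla$, $\Gamma_{ij}^k$, $R_{ij}$, $R$ are the Levi-Civita connection, Christoffel symbols, Ricci and scalar curvature of $g(t)$, and $|V|^2=g^{pq}V_pV_q$. The degenerate space-time metric on $T^*\tilde M$ is $\tilde g^{ij}=g^{ij}$ if $i,j\ge1$ and $\tilde g^{ij}=0$ if $i=0$ or $j=0$. The space-time connection $\tilde\nabla$ is the symmetric connection ($\tilde\Gamma_{ij}^k=\tilde\Gamma_{ji}^k$) with $\tilde\Gamma^k_{ij}=\Gamma^k_{ij}$ if $i,j,k\ge1$; $\tilde\Gamma^0_{ij}=0$ if $i,j\ge0$; $\tilde\Gamma^k_{i0}=-R^k_i+\nabla_iV^k$ if $i,k\ge1$; $\tilde\Gamma^k_{00}=-\frac12\nabla^k(R+|V|^2)+g^{kp}\frac{\partial}{\partial t}V_p$ if $k\ge1$. Its curvatures are $\tilde R^l_{ijk}=\partial_i\tilde\Gamma^l_{jk}-\partial_j\tilde\Gamma^l_{ik}+\tilde\Gamma^p_{jk}\tilde\Gamma^l_{ip}-\tilde\Gamma^p_{ik}\tilde\Gamma^l_{jp}$ and $\tilde R_{jk}=\tilde R^p_{pjk}$ (indices from $0$ to $n$; the same convention is used on $M$, so $R_{jk}=R^p_{pjk}$). Space-time indices are raised with $\tilde g$: $\tilde R^k_j=\tilde g^{kl}\tilde R_{jl}$, $\tilde V^k=\tilde g^{kl}\tilde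 V_l$, $\tilde\nabla^k=\tilde g^{kl}\tilde\nabla_l$. $\frac{\partial}{\partial t}$ of $\tilde g^{ij}$ and $\tilde\Gamma^k_{ij}$ is the time derivative of components in these coordinates. *)

theory Defs
  imports "HOL-Analysis.Analysis"
begin

section \<open>Smooth functions\<close>

text \<open>Derivatives are taken within the domain, so that the notion also makes sense on
  sets with boundary such as \<open>U \<times> [0,T)\<close> with \<open>U\<close> open: there it means smooth up to
  \<open>t = 0\<close>, with one-sided time derivatives at \<open>t = 0\<close>.  It is used only for open sets and
  for such products, where the derivative within the set is unique.\<close>

primrec Ck_on :: "nat \<Rightarrow> 'a::euclidean_space set \<Rightarrow> ('a \<Rightarrow> 'b::euclidean_space) \<Rightarrow> bool" where
  "Ck_on 0 D f \<longleftrightarrow> continuous_on D f"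
| "Ck_on (Suc k) D f \<longleftrightarrow>
     (\<exists>f'. (\<forall>z\<in>D. (f has_derivative f' z) (at z within D)) \<and> (\<forall>v. Ck_on k D (\<lambda>z. f' z v)))"

definition smooth_on :: "'a::euclidean_space set \<Rightarrow> ('a \<Rightarrow> 'b::euclidean_space) \<Rightarrow> bool" where
  "smooth_on D f \<longleftrightarrow> (\<forall>k. Ck_on k D f)"


section \<open>Smooth manifolds\<close>

type_synonym ('m, 'n) chart = "'m set \<times> ('m \<Rightarrow> real ^ 'n)"

definition chart_image :: "('m, 'n::finite) chart \<Rightarrow> (real ^ 'n) set" where
  "chart_image c = snd c ` fst c"

definition chart_point :: "('m, 'n::finite) chart \<Rightarrow> real ^ 'n \<Rightarrow> 'm" where
  "chart_point c = inv_into (fst c) (snd c)"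

definition is_chart :: "'m topology \<Rightarrow> ('m, 'n::finite) chart \<Rightarrow> bool" where
  "is_chart M c \<longleftrightarrow> openin M (fst c) \<and> open (chart_image c) \<and>
     homeomorphic_map (subtopology M (fst c)) (top_of_set (chart_image c)) (snd c)"

definition overlap :: "('m, 'n::finite) chart \<Rightarrow> ('m, 'n) chart \<Rightarrow> (real ^ 'n) set" where
  "overlap c d = snd c ` (fst c \<inter> fst d)"

definition transition :: "('m, 'n::finite) chart \<Rightarrow> ('m, 'n) chart \<Rightarrow> real ^ 'n \<Rightarrow> real ^ 'n" where
  "transition c d x = snd d (chart_point c x)"

text \<open>\<open>jacobian c d x a i\<close> is \<open>\<partial>y\<^sup>a/\<partial>x\<^sup>i\<close> at \<open>x\<close>, where \<open>x\<close> and \<open>y\<close> are the coordinates of the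
  charts \<open>c\<close> and \<open>d\<close>.\<close>

definition jacobian ::
  "('m, 'n::finite) chart \<Rightarrow> ('m, 'n) chart \<Rightarrow> real ^ 'n \<Rightarrow> 'n \<Rightarrow> 'n \<Rightarrow> real" where
  "jacobian c d x a i = frechet_derivative (transition c d) (at x) (axis i 1) $ a"

text \<open>The atlas need not be maximal; the dimension is \<open>CARD('n)\<close>.\<close>

definition smooth_manifold :: "'m topology \<Rightarrow> ('m, 'n::finite) chart set \<Rightarrow> bool" where
  "smooth_manifold M A \<longleftrightarrow> Hausdorff_space M \<and> second_countable M \<and>
     (\<forall>c\<in>A. is_chart M c) \<and> (\<Union>c\<in>A. fst c) = topspace M \<and>
     (\<forall>c\<in>A. \<forall>d\<in>A. smooth_on (overlap c d) (transition c d))"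


section \<open>Time-dependent tensor fields on a manifold\<close>

text \<open>The time interval \<open>[0,T)\<close>, where \<open>T = \<infinity>\<close> is allowed.\<close>

definition time_dom :: "ereal \<Rightarrow> real set" where
  "time_dom T = {t. 0 \<le> t \<and> ereal t < T}"

text \<open>A scalar field in local coordinates \<open>(x, t)\<close> of \<open>M \<times> [0,T)\<close>.  Tensor fields on \<open>M\<close> are
  given classically, by their components in every chart of the atlas, subject to the tensor
  transformation law.\<close>

type_synonym 'n field = "(real ^ 'n) \<times> real \<Rightarrow> real"

definition smooth_function_on_spacetime ::
  "('m, 'n::finite) chart set \<Rightarrow> ereal \<Rightarrow> ('m \<times> real \<Rightarrow> real) \<Rightarrow> bool" where
  "smooth_function_on_spacetime A T f \<longleftrightarrow>
     (\<forall>c\<in>A. smooth_on (chart_image c \<times> time_dom T) (\<lambda>(x, t). f (chart_point c x, t)))"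

definition smooth_form_family ::
  "('m, 'n::finite) chart set \<Rightarrow> ereal \<Rightarrow> (('m, 'n) chart \<Rightarrow> 'n \<Rightarrow> 'n field) \<Rightarrow> bool" where
  "smooth_form_family A T V \<longleftrightarrow>
     (\<forall>c\<in>A. \<forall>i. smooth_on (chart_image c \<times> time_dom T) (V c i)) \<and>
     (\<forall>c\<in>A. \<forall>d\<in>A. \<forall>x\<in>overlap c d. \<forall>t\<in>time_dom T. \<forall>i.
        V c i (x, t) = (\<Sum>a\<in>UNIV. jacobian c d x a i * V d a (transition c d x, t)))"

definition smooth_metric_family ::
  "('m, 'n::finite) chart set \<Rightarrow> ereal \<Rightarrow> (('m, 'n) chart \<Rightarrow> 'n \<Rightarrow> 'n \<Rightarrow> 'n field) \<Rightarrow> bool" where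
  "smooth_metric_family A T g \<longleftrightarrow>
     (\<forall>c\<in>A. \<forall>i j. smooth_on (chart_image c \<times> time_dom T) (g c i j)) \<and>
     (\<forall>c\<in>A. \<forall>d\<in>A. \<forall>x\<in>overlap c d. \<forall>t\<in>time_dom T. \<forall>i j.
        g c i j (x, t) = (\<Sum>a\<in>UNIV. \<Sum>b\<in>UNIV.
          jacobian c d x a i * jacobian c d x b j * g d a b (transition c d x, t))) \<and>
     (\<forall>c\<in>A. \<forall>z\<in>chart_image c \<times> time_dom T.
        (\<forall>i j. g c i j z = g c j i z) \<and>
        (\<forall>v::real ^ 'n. v \<noteq> 0 \<longrightarrow> (\<Sum>i\<in>UNIV. \<Sum>j\<in>UNIV. g c i j z * (v $ i) * (v $ j)) > 0))"


section \<open>Coordinate calculus\<close>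

text \<open>Space-time indices are of type \<open>'n option\<close>: \<open>None\<close> is the index \<open>0\<close> (time) and \<open>Some i\<close>
  with \<open>i :: 'n\<close> are the spatial indices \<open>1, \<dots>, n\<close>.\<close>

definition spatial_pd :: "'n::finite \<Rightarrow> 'n field \<Rightarrow> 'n field" where
  "spatial_pd i f = (\<lambda>(x, t). vector_derivative (\<lambda>s. f (x + s *\<^sub>R axis i 1, t)) (at 0))"

primrec pd :: "ereal \<Rightarrow> 'n::finite option \<Rightarrow> 'n field \<Rightarrow> 'n field" where
  "pd T None f = (\<lambda>(x, t). vector_derivative (\<lambda>s. f (x, s)) (at t within time_dom T))"
| "pd T (Some i) f = spatial_pd i f"

text \<open>The following operators are used both on \<open>M\<close> (index type \<open>'n\<close>) and on space-time (index
  type \<open>'n option\<close>).  The argument \<open>D i\<close> is the partial derivative \<open>\<partial>\<^sub>i\<close>.  In all component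
  functions the upper index comes first: \<open>\<Gamma> k i j\<close> is \<open>\<Gamma>\<^sup>k\<^sub>i\<^sub>j\<close>, \<open>curvature D \<Gamma> l i j k\<close> is
  \<open>R\<^sup>l\<^sub>i\<^sub>j\<^sub>k\<close>, \<open>A k j\<close> is \<open>A\<^sup>k\<^sub>j\<close>.  The first index argument of the covariant derivatives is the
  direction of differentiation.\<close>

definition curvature ::
  "('k::finite \<Rightarrow> ('p \<Rightarrow> real) \<Rightarrow> 'p \<Rightarrow> real) \<Rightarrow> ('k \<Rightarrow> 'k \<Rightarrow> 'k \<Rightarrow> 'p \<Rightarrow> real) \<Rightarrow>
   'k \<Rightarrow> 'k \<Rightarrow> 'k \<Rightarrow> 'k \<Rightarrow> 'p \<Rightarrow> real" where
  "curvature D \<Gamma> l i j k z = D i (\<Gamma> l j k) z - D j (\<Gamma> l i k) z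
     + (\<Sum>p\<in>UNIV. \<Gamma> p j k z * \<Gamma> l i p z) - (\<Sum>p\<in>UNIV. \<Gamma> p i k z * \<Gamma> l j p z)"

definition ricci ::
  "('k::finite \<Rightarrow> ('p \<Rightarrow> real) \<Rightarrow> 'p \<Rightarrow> real) \<Rightarrow> ('k \<Rightarrow> 'k \<Rightarrow> 'k \<Rightarrow> 'p \<Rightarrow> real) \<Rightarrow>
   'k \<Rightarrow> 'k \<Rightarrow> 'p \<Rightarrow> real" where
  "ricci D \<Gamma> j k z = (\<Sum>p\<in>UNIV. curvature D \<Gamma> p p j k z)"

definition cov_vector ::
  "('k::finite \<Rightarrow> ('p \<Rightarrow> real) \<Rightarrow> 'p \<Rightarrow> real) \<Rightarrow> ('k \<Rightarrow> 'k \<Rightarrow> 'k \<Rightarrow> 'p \<Rightarrow> real) \<Rightarrow>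
   ('k \<Rightarrow> 'p \<Rightarrow> real) \<Rightarrow> 'k \<Rightarrow> 'k \<Rightarrow> 'p \<Rightarrow> real" where
  "cov_vector D \<Gamma> X i k z = D i (X k) z + (\<Sum>p\<in>UNIV. \<Gamma> k i p z * X p z)"

definition cov_form ::
  "('k::finite \<Rightarrow> ('p \<Rightarrow> real) \<Rightarrow> 'p \<Rightarrow> real) \<Rightarrow> ('k \<Rightarrow> 'k \<Rightarrow> 'k \<Rightarrow> 'p \<Rightarrow> real) \<Rightarrow>
   ('k \<Rightarrow> 'p \<Rightarrow> real) \<Rightarrow> 'k \<Rightarrow> 'k \<Rightarrow> 'p \<Rightarrow> real" where
  "cov_form D \<Gamma> \<omega> i j z = D i (\<omega> j) z - (\<Sum>p\<in>UNIV. \<Gamma> p i j z * \<omega> p z)"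

definition cov_mixed ::
  "('k::finite \<Rightarrow> ('p \<Rightarrow> real) \<Rightarrow> 'p \<Rightarrow> real) \<Rightarrow> ('k \<Rightarrow> 'k \<Rightarrow> 'k \<Rightarrow> 'p \<Rightarrow> real) \<Rightarrow>
   ('k \<Rightarrow> 'k \<Rightarrow> 'p \<Rightarrow> real) \<Rightarrow> 'k \<Rightarrow> 'k \<Rightarrow> 'k \<Rightarrow> 'p \<Rightarrow> real" where
  "cov_mixed D \<Gamma> A i k j z = D i (A k j) z
     + (\<Sum>p\<in>UNIV. \<Gamma> k i p z * A p j z) - (\<Sum>p\<in>UNIV. \<Gamma> p i j z * A k p z)"

definition cov_bilinear ::
  "('k::finite \<Rightarrow> ('p \<Rightarrow> real) \<Rightarrow> 'p \<Rightarrow> real) \<Rightarrow> ('k \<Rightarrow> 'k \<Rightarrow> 'k \<Rightarrow> 'p \<Rightarrow> real) \<Rightarrow>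
   ('k \<Rightarrow> 'k \<Rightarrow> 'p \<Rightarrow> real) \<Rightarrow> 'k \<Rightarrow> 'k \<Rightarrow> 'k \<Rightarrow> 'p \<Rightarrow> real" where
  "cov_bilinear D \<Gamma> B i j k z = D i (B j k) z
     - (\<Sum>p\<in>UNIV. \<Gamma> p i j z * B p k z) - (\<Sum>p\<in>UNIV. \<Gamma> p i k z * B j p z)"

text \<open>Raising an index with \<open>h\<close> (components \<open>h\<^sup>i\<^sup>j\<close>): \<open>raise h \<omega> k\<close> is \<open>h\<^sup>k\<^sup>l \<omega>\<^sub>l\<close>.\<close>

definition raise ::
  "('k::finite \<Rightarrow> 'k \<Rightarrow> 'p \<Rightarrow> real) \<Rightarrow> ('k \<Rightarrow> 'p \<Rightarrow> real) \<Rightarrow> 'k \<Rightarrow> 'p \<Rightarrow> real" where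
  "raise h \<omega> k z = (\<Sum>l\<in>UNIV. h k l z * \<omega> l z)"


section \<open>Riemannian geometry of \<open>g(t)\<close> in a chart\<close>

definition metric_inv :: "('n::finite \<Rightarrow> 'n \<Rightarrow> 'n field) \<Rightarrow> 'n \<Rightarrow> 'n \<Rightarrow> 'n field" where
  "metric_inv g i j z = matrix_inv (\<chi> a b. g a b z) $ i $ j"

definition christoffel :: "('n::finite \<Rightarrow> 'n \<Rightarrow> 'n field) \<Rightarrow> 'n \<Rightarrow> 'n \<Rightarrow> 'n \<Rightarrow> 'n field" where
  "christoffel g k i j z = (1/2) * (\<Sum>l\<in>UNIV. metric_inv g k l z *
     (spatial_pd i (g j l) z + spatial_pd j (g i l) z - spatial_pd l (g i j) z))"

definition Ric :: "('n::finite \<Rightarrow> 'n \<Rightarrow> 'n field) \<Rightarrow> 'n \<Rightarrow> 'n \<Rightarrow> 'n field" where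
  "Ric g = ricci spatial_pd (christoffel g)"

definition scal :: "('n::finite \<Rightarrow> 'n \<Rightarrow> 'n field) \<Rightarrow> 'n field" where
  "scal g z = (\<Sum>j\<in>UNIV. \<Sum>k\<in>UNIV. metric_inv g j k z * Ric g j k z)"

definition norm_sq :: "('n::finite \<Rightarrow> 'n \<Rightarrow> 'n field) \<Rightarrow> ('n \<Rightarrow> 'n field) \<Rightarrow> 'n field" where
  "norm_sq g V z = (\<Sum>p\<in>UNIV. \<Sum>q\<in>UNIV. metric_inv g p q z * V p z * V q z)"

definition modified_ricci_flow ::
  "('m, 'n::finite) chart set \<Rightarrow> ereal \<Rightarrow> (('m, 'n) chart \<Rightarrow> 'n \<Rightarrow> 'n \<Rightarrow> 'n field) \<Rightarrow>
   (('m, 'n) chart \<Rightarrow> 'n \<Rightarrow> 'n field) \<Rightarrow> bool" where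
  "modified_ricci_flow A T g V \<longleftrightarrow>
     (\<forall>c\<in>A. \<forall>x\<in>chart_image c. \<forall>t\<in>time_dom T. \<forall>i j.
        ((\<lambda>s. g c i j (x, s)) has_real_derivative
          - 2 * Ric (g c) i j (x, t)
          + cov_form spatial_pd (christoffel (g c)) (V c) i j (x, t)
          + cov_form spatial_pd (christoffel (g c)) (V c) j i (x, t)) (at t within time_dom T))"


section \<open>The space-time metric and connection\<close>

fun st_metric :: "('n::finite \<Rightarrow> 'n \<Rightarrow> 'n field) \<Rightarrow> 'n option \<Rightarrow> 'n option \<Rightarrow> 'n field" where
  "st_metric g (Some i) (Some j) = metric_inv g i j"
| "st_metric g _ _ = (\<lambda>z. 0)"

definition st_mixed_coeff ::
  "('n::finite \<Rightarrow> 'n \<Rightarrow> 'n field) \<Rightarrow> ('n \<Rightarrow> 'n field) \<Rightarrow> 'n \<Rightarrow> 'n \<Rightarrow> 'n field" where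
  "st_mixed_coeff g V k i z =
     - raise (metric_inv g) (Ric g i) k z
     + cov_vector spatial_pd (christoffel g) (raise (metric_inv g) V) i k z"

fun st_conn ::
  "ereal \<Rightarrow> ('n::finite \<Rightarrow> 'n \<Rightarrow> 'n field) \<Rightarrow> ('n \<Rightarrow> 'n field) \<Rightarrow>
   'n option \<Rightarrow> 'n option \<Rightarrow> 'n option \<Rightarrow> 'n field" where
  "st_conn T g V None _ _ = (\<lambda>z. 0)"
| "st_conn T g V (Some k) (Some i) (Some j) = christoffel g k i j"
| "st_conn T g V (Some k) (Some i) None = st_mixed_coeff g V k i"
| "st_conn T g V (Some k) None (Some i) = st_mixed_coeff g V k i"
| "st_conn T g V (Some k) None None = (\<lambda>z.
     - (1/2) * raise (metric_inv g) (\<lambda>p. spatial_pd p (\<lambda>w. scal g w + norm_sq g V w)) k z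
     + (\<Sum>p\<in>UNIV. metric_inv g k p z * pd T None (V p) z))"

definition st_Ric ::
  "ereal \<Rightarrow> ('n::finite \<Rightarrow> 'n \<Rightarrow> 'n field) \<Rightarrow> ('n \<Rightarrow> 'n field) \<Rightarrow>
   'n option \<Rightarrow> 'n option \<Rightarrow> 'n field" where
  "st_Ric T g V = ricci (pd T) (st_conn T g V)"

text \<open>The 1-form \<open>V + \<eta> dt\<close>, in the coordinates of the chart \<open>c\<close>.\<close>

primrec st_form ::
  "('m, 'n::finite) chart \<Rightarrow> ('m \<times> real \<Rightarrow> real) \<Rightarrow> ('n \<Rightarrow> 'n field) \<Rightarrow> 'n option \<Rightarrow> 'n field" where
  "st_form c \<eta> V None = (\<lambda>(x, t). \<eta> (chart_point c x, t))"
| "st_form c \<eta> V (Some i) = V i"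

text \<open>For a space-time 1-form \<open>W\<close>:
  \<open>R\<^sup>k\<^sub>j - (1/2) \<nabla>\<^sub>j W\<^sup>k - (1/2) \<nabla>\<^sup>k W\<^sub>j\<close> and \<open>R\<^sub>i\<^sub>j - (1/2) \<nabla>\<^sub>i W\<^sub>j - (1/2) \<nabla>\<^sub>j W\<^sub>i\<close>, all objects being
  those of space-time.\<close>

definition st_flow_mixed ::
  "ereal \<Rightarrow> ('n::finite \<Rightarrow> 'n \<Rightarrow> 'n field) \<Rightarrow> ('n \<Rightarrow> 'n field) \<Rightarrow> ('n option \<Rightarrow> 'n field) \<Rightarrow>
   'n option \<Rightarrow> 'n option \<Rightarrow> 'n field" where
  "st_flow_mixed T g V W k j z =
     raise (st_metric g) (st_Ric T g V j) k z
     - (1/2) * cov_vector (pd T) (st_conn T g V) (raise (st_metric g) W) j k z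
     - (1/2) * raise (st_metric g) (\<lambda>l. cov_form (pd T) (st_conn T g V) W l j) k z"

definition st_flow_bilinear ::
  "ereal \<Rightarrow> ('n::finite \<Rightarrow> 'n \<Rightarrow> 'n field) \<Rightarrow> ('n \<Rightarrow> 'n field) \<Rightarrow> ('n option \<Rightarrow> 'n field) \<Rightarrow>
   'n option \<Rightarrow> 'n option \<Rightarrow> 'n field" where
  "st_flow_bilinear T g V W i j z =
     st_Ric T g V i j z
     - (1/2) * cov_form (pd T) (st_conn T g V) W i j z
     - (1/2) * cov_form (pd T) (st_conn T g V) W j i z"

end

theory Submission
  imports Defs
begin

text \<open>Write \<open>G\<close> for the symmetric array with \<open>G\<^sub>i\<^sub>j = g\<^sub>i\<^sub>j\<close>, \<open>G\<^sub>0\<^sub>i = V\<^sub>i\<close>, \<open>G\<^sub>0\<^sub>0 = R + |V|\<^sup>2\<close>.  By the flow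
  equation the space-time connection is \<open>g\<^sup>k\<^sup>l\<close> times the Christoffel symbols of the first kind of \<open>G\<close>; hence it
  is torsion-free, the degenerate metric is parallel, and the space-time Ricci tensor is symmetric.

  The vector field \<open>X = \<partial>\<^sub>t - V\<^sup>k \<partial>\<^sub>k\<close> satisfies the soliton equation \<open>\<nabla>\<^sub>i X\<^sup>k = - R\<^sup>k\<^sub>i\<close> on space-time.
  Tracing the Ricci identity for \<open>X\<close> and using the contracted second Bianchi identity gives
  \<open>R\<^sub>j\<^sub>q X\<^sup>q = (1/2) \<partial>\<^sub>j R\<close>, first for spatial \<open>j\<close>, which yields \<open>R\<^sub>j\<^sub>0\<close> and the soliton equation in the
  time direction, and then for \<open>j = 0\<close>, which yields \<open>R\<^sub>0\<^sub>0\<close>.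

  Consequently, for \<open>W = V + \<eta> dt\<close>, the form \<open>B\<^sub>i\<^sub>j = R\<^sub>i\<^sub>j - (1/2) \<nabla>\<^sub>i W\<^sub>j - (1/2) \<nabla>\<^sub>j W\<^sub>i\<close> equals \<open>-(1/2) \<partial>\<^sub>t G\<^sub>i\<^sub>j\<close> up to derivatives of the
  potential \<open>R + |V|\<^sup>2 - \<eta>\<close>, which cancel in the second equation, and that equation becomes the time
  derivative of the formula for the connection in terms of \<open>G\<close>.\<close>

section \<open>Smooth functions\<close>

lemma Ck_on_cong:
  assumes "\<And>z. z \<in> D \<Longrightarrow> f z = g z" and "Ck_on k D f"
  shows "Ck_on k D g"
proof (cases k)
  case 0
  then show ?thesis using assms continuous_on_cong[of D D f g] by simp
next
  case (Suc m)
  then obtain f' where "\<forall>z\<in>D. (f has_derivative f' z) (at z within D)"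
      "\<forall>v. Ck_on m D (\<lambda>z. f' z v)"
    using assms(2) by auto
  moreover from this have "\<forall>z\<in>D. (g has_derivative f' z) (at z within D)"
    using assms(1) by (metis has_derivative_transform)
  ultimately show ?thesis using Suc by auto
qed

text \<open>\<open>Ck_on (Suc k)\<close> speaks only of the derivative, so continuity at the bottom
  of the induction has to come from differentiability.\<close>

lemma Ck_on_SucD: "Ck_on (Suc k) D f \<Longrightarrow> Ck_on k D f"
proof (induction k arbitrary: f)
  case 0
  then show ?case
    by (auto simp: continuous_on_eq_continuous_within dest: has_derivative_continuous)
next
  case (Suc k)
  then obtain f' where "\<forall>z\<in>D. (f has_derivative f' z) (at z within D)"
      "\<forall>v. Ck_on (Suc k) D (\<lambda>z. f' z v)"
    by (auto simp del: Ck_on.simps(2) simp: Ck_on.simps(2)[of "Suc k"])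
  then show ?case using Suc.IH by auto
qed

lemma Ck_on_const: "Ck_on k D (\<lambda>z. c)"
proof (induction k arbitrary: c)
  case (Suc k)
  then show ?case by (auto intro!: exI[of _ "\<lambda>z v. 0"])
qed simp

lemma Ck_on_add: "Ck_on k D f \<Longrightarrow> Ck_on k D g \<Longrightarrow> Ck_on k D (\<lambda>z. f z + g z)"
proof (induction k arbitrary: f g)
  case 0
  then show ?case by (auto intro: continuous_on_add)
next
  case (Suc k)
  then obtain f' g' where "\<forall>z\<in>D. (f has_derivative f' z) (at z within D)"
      "\<forall>v. Ck_on k D (\<lambda>z. f' z v)" "\<forall>z\<in>D. (g has_derivative g' z) (at z within D)"
      "\<forall>v. Ck_on k D (\<lambda>z. g' z v)" by auto
  then show ?case using Suc.IH
    by (auto intro!: exI[of _ "\<lambda>z v. f' z v + g' z v"] has_derivative_add)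
qed

lemma Ck_on_mult:
  fixes f g :: "'a::euclidean_space \<Rightarrow> real"
  shows "Ck_on k D f \<Longrightarrow> Ck_on k D g \<Longrightarrow> Ck_on k D (\<lambda>z. f z * g z)"
proof (induction k arbitrary: f g)
  case 0
  then show ?case by (auto intro: continuous_on_mult)
next
  case (Suc k)
  have fg: "Ck_on k D f" "Ck_on k D g" using Suc.prems Ck_on_SucD by blast+
  obtain f' g' where "\<forall>z\<in>D. (f has_derivative f' z) (at z within D)"
      "\<forall>v. Ck_on k D (\<lambda>z. f' z v)" "\<forall>z\<in>D. (g has_derivative g' z) (at z within D)"
      "\<forall>v. Ck_on k D (\<lambda>z. g' z v)" using Suc.prems by auto
  then show ?case using Suc.IH fg
    by (auto intro!: exI[of _ "\<lambda>z v. f z * g' z v + f' z v * g z"] has_derivative_mult Ck_on_add)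
qed

text \<open>The derivative of 1/f is a product of 1/f twice with the derivative of f. By induction
  1/f is already of class C^k, so the product is too.\<close>

lemma Ck_on_inverse:
  fixes f :: "'a::euclidean_space \<Rightarrow> real"
  assumes "\<And>z. z \<in> D \<Longrightarrow> f z \<noteq> 0"
  shows "Ck_on k D f \<Longrightarrow> Ck_on k D (\<lambda>z. inverse (f z))"
proof (induction k)
  case 0
  then show ?case using assms by (auto intro!: continuous_on_inverse)
next
  case (Suc k)
  have f: "Ck_on k D (\<lambda>z. inverse (f z))" using Suc Ck_on_SucD by blast
  obtain f' where f': "\<forall>z\<in>D. (f has_derivative f' z) (at z within D)"
      "\<forall>v. Ck_on k D (\<lambda>z. f' z v)" using Suc.prems by auto
  \<comment> \<open>The sign is written as a constant factor, so that closure under products covers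
    it.\<close>
  have "Ck_on k D (\<lambda>z. - 1 * (inverse (f z) * f' z v * inverse (f z)))" for v
    using f f' by (intro Ck_on_mult Ck_on_const) auto
  then have "Ck_on k D (\<lambda>z. - (inverse (f z) * f' z v * inverse (f z)))" for v
    by simp
  then show ?case using assms f'
    by (auto intro!: exI[of _ "\<lambda>z v. - (inverse (f z) * f' z v * inverse (f z))"]
        has_derivative_inverse)
qed

lemma smooth_on_cong: "(\<And>z. z \<in> D \<Longrightarrow> f z = g z) \<Longrightarrow> smooth_on D f \<Longrightarrow> smooth_on D g"
  unfolding smooth_on_def using Ck_on_cong by blast

lemma smooth_on_const: "smooth_on D (\<lambda>z. c)"
  by (simp add: smooth_on_def Ck_on_const)

lemma smooth_on_add: "smooth_on D f \<Longrightarrow> smooth_on D g \<Longrightarrow> smooth_on D (\<lambda>z. f z + g z)"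
  by (simp add: smooth_on_def Ck_on_add)

section \<open>Smoothness of finite sums, products, determinants and inverse matrices\<close>

context
  fixes D :: "'a::euclidean_space set"
begin

lemma smooth_on_mult:
  fixes f g :: "'a \<Rightarrow> real"
  shows "smooth_on D f \<Longrightarrow> smooth_on D g \<Longrightarrow> smooth_on D (\<lambda>z. f z * g z)"
  by (simp add: smooth_on_def Ck_on_mult)

lemma smooth_on_divide:
  fixes f g :: "'a \<Rightarrow> real"
  assumes "smooth_on D f" "smooth_on D g" "\<And>z. z \<in> D \<Longrightarrow> g z \<noteq> 0"
  shows "smooth_on D (\<lambda>z. f z / g z)"
  using assms smooth_on_mult[of f "\<lambda>z. inverse (g z)"] 
  by (simp add: smooth_on_def Ck_on_inverse divide_inverse)

lemma smooth_on_sum: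
  fixes f :: "'b \<Rightarrow> 'a \<Rightarrow> real"
  assumes "\<And>i. i \<in> K \<Longrightarrow> smooth_on D (f i)"
  shows "smooth_on D (\<lambda>z. \<Sum>i\<in>K. f i z)"
  using assms by (induction K rule: infinite_finite_induct) (auto intro: smooth_on_const smooth_on_add)

lemma smooth_on_prod:
  fixes f :: "'b \<Rightarrow> 'a \<Rightarrow> real"
  assumes "\<And>i. i \<in> K \<Longrightarrow> smooth_on D (f i)"
  shows "smooth_on D (\<lambda>z. \<Prod>i\<in>K. f i z)"
  using assms by (induction K rule: infinite_finite_induct) (auto intro: smooth_on_const smooth_on_mult)

lemma smooth_on_det:
  fixes a :: "'n::finite \<Rightarrow> 'n \<Rightarrow> 'a \<Rightarrow> real"
  assumes "\<And>i j. smooth_on D (a i j)"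
  shows "smooth_on D (\<lambda>z. det (\<chi> i j. a i j z))"
  unfolding det_def vec_lambda_beta
  by (intro smooth_on_sum smooth_on_mult smooth_on_const smooth_on_prod assms)

lemma invertible_matrix_inv:
  fixes A :: "'b::semiring_1^'n^'n"
  assumes "invertible A"
  shows "A ** matrix_inv A = mat 1" and "matrix_inv A ** A = mat 1"
  using someI_ex[of "\<lambda>B. A ** B = mat 1 \<and> B ** A = mat 1"] assms
  by (auto simp: matrix_inv_def invertible_def)

text \<open>By Cramer's rule each entry of the inverse is a quotient of determinants of smooth
  matrices, with a denominator that does not vanish on \<open>D\<close>.\<close>

lemma smooth_on_matrix_inv:
  fixes a :: "'n::finite \<Rightarrow> 'n \<Rightarrow> 'a \<Rightarrow> real"
  assumes "\<And>i j. smooth_on D (a i j)" "\<And>z. z \<in> D \<Longrightarrow> invertible (\<chi> i j. a i j z)"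
  shows "smooth_on D (\<lambda>z. matrix_inv (\<chi> i j. a i j z) $ k $ l)"
proof -
  \<comment> \<open>The matrix \<open>a\<close> with column \<open>k\<close> replaced by the
    \<open>l\<close>-th basis vector.\<close>
  define b where "b i j = (if j = k then (\<lambda>z. if i = l then 1 else 0) else a i j)" for i j
  have "smooth_on D (b i j)" for i j
    unfolding b_def using assms(1) by (auto intro: smooth_on_const)
  then have "smooth_on D (\<lambda>z. det (\<chi> i j. b i j z) / det (\<chi> i j. a i j z))"
    using assms by (intro smooth_on_divide smooth_on_det) (auto simp: invertible_det_nz)
  moreover have "det (\<chi> i j. b i j z) / det (\<chi> i j. a i j z) = matrix_inv (\<chi> i j. a i j z) $ k $ l"
    if "z \<in> D" for z
  proof -
    let ?A = "\<chi> i j. a i j z"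
    have inv: "invertible ?A" using that assms by auto
    have "?A *v (matrix_inv ?A *v axis l 1) = axis l 1"
      by (simp add: matrix_vector_mul_assoc invertible_matrix_inv[OF inv])
    then have "matrix_inv ?A *v axis l 1
        = (\<chi> k. det (\<chi> i j. if j = k then axis l 1 $ i else ?A $ i $ j) / det ?A)"
      using cramer[of ?A] inv by (simp add: invertible_det_nz)
    then have "(matrix_inv ?A *v axis l 1) $ k
        = det (\<chi> i j. if j = k then axis l 1 $ i else ?A $ i $ j) / det ?A" by simp
    moreover have "(matrix_inv ?A *v axis l 1) $ k = matrix_inv ?A $ k $ l"
      by (simp add: matrix_vector_mul_component inner_axis)
    moreover have "(\<chi> i j. if j = k then axis l 1 $ i else ?A $ i $ j) = (\<chi> i j. b i j z)"
      by (auto simp: b_def vec_eq_iff axis_def)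
    ultimately show ?thesis by simp
  qed
  ultimately show ?thesis by (rule smooth_on_cong[rotated])
qed

end

section \<open>Symmetry of second derivatives up to the boundary\<close>

lemma has_real_derivative_along_line:
  fixes f :: "'a::real_normed_vector \<Rightarrow> real"
  assumes f: "(f has_derivative f') (at (z + (s - s0) *\<^sub>R v) within D)"
    and D: "\<And>s. s \<in> J \<Longrightarrow> z + (s - s0) *\<^sub>R v \<in> D"
  shows "((\<lambda>s. f (z + (s - s0) *\<^sub>R v)) has_real_derivative f' v) (at s within J)"
proof -
  let ?c = "\<lambda>s. z + (s - s0) *\<^sub>R v"
  have c: "(?c has_derivative (\<lambda>h. h *\<^sub>R v)) (at s within J)"
    by (auto intro!: derivative_eq_intros)
  have "(f has_derivative f') (at (?c s) within ?c ` J)"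
    using f by (rule has_derivative_subset) (use D in auto)
  from has_derivative_in_compose[OF c this]
  have *: "((\<lambda>s. f (?c s)) has_derivative (\<lambda>h. f' (h *\<^sub>R v))) (at s within J)" .
  have "linear f'" using f has_derivative_linear by blast
  then have "(\<lambda>h. f' (h *\<^sub>R v)) = (*) (f' v)"
    by (auto simp: linear_scale mult.commute)
  with * show ?thesis by (simp add: has_field_derivative_def)
qed

text \<open>Two mean value theorems: one for the increment of f across \<open>e w\<close> as a
  function of the step along \<open>v\<close>, one for the derivative along \<open>v\<close> as a
  function of the step along \<open>w\<close>. All points used lie in the parallelogram contained in
  \<open>D\<close>.\<close>

lemma second_difference_mvt:
  fixes f :: "'a::real_normed_vector \<Rightarrow> real"
  assumes D: "\<And>a b. a \<in> {0..e} \<Longrightarrow> b \<in> {0..e} \<Longrightarrow> z + a *\<^sub>R v + b *\<^sub>R w \<in> D"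
    and f: "\<And>y. y \<in> D \<Longrightarrow> (f has_derivative f' y) (at y within D)"
    and p: "\<And>y. y \<in> D \<Longrightarrow> ((\<lambda>y. f' y v) has_derivative p' y) (at y within D)"
    and e: "0 < e"
  shows "\<exists>a\<in>{0..e}. \<exists>b\<in>{0..e}.
    f (z + e *\<^sub>R v + e *\<^sub>R w) - f (z + e *\<^sub>R v) - f (z + e *\<^sub>R w) + f z
      = e * e * p' (z + a *\<^sub>R v + b *\<^sub>R w) w"
proof -
  define h where "h s = f ((z + e *\<^sub>R w) + (s - 0) *\<^sub>R v) - f (z + (s - 0) *\<^sub>R v)" for s
  define h' where "h' s = f' ((z + e *\<^sub>R w) + (s - 0) *\<^sub>R v) v - f' (z + (s - 0) *\<^sub>R v) v" for s
  have D': "(z + e *\<^sub>R w) + (s - 0) *\<^sub>R v \<in> D" "z + (s - 0) *\<^sub>R v \<in> D" if "s \<in> {0..e}" for s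
    using that D[of s e] D[of s 0] e by (auto simp: algebra_simps)
  have "(h has_real_derivative h' s) (at s within {0..e})" if "s \<in> {0..e}" for s
    unfolding h_def h'_def
    by (intro DERIV_diff has_real_derivative_along_line[where D = D] f D' that)
  then have "\<exists>s\<in>{0<..<e}. h e - h 0 = h' s * (e - 0)"
    using mvt_simple[OF e, of h "\<lambda>s. (*) (h' s)"] by (auto simp: has_field_derivative_def)
  then obtain a where a: "a \<in> {0<..<e}" "h e - h 0 = h' a * e" by auto
  define k where "k s = f' ((z + a *\<^sub>R v) + (s - 0) *\<^sub>R w) v" for s
  have D'': "(z + a *\<^sub>R v) + (s - 0) *\<^sub>R w \<in> D" if "s \<in> {0..e}" for s
    using that D[of a s] a by auto
  have "(k has_real_derivative p' ((z + a *\<^sub>R v) + (s - 0) *\<^sub>R w) w) (at s within {0..e})"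
    if "s \<in> {0..e}" for s
    unfolding k_def
    by (intro has_real_derivative_along_line[where f = "\<lambda>y. f' y v" and D = D] p D'' that)
  then have "\<exists>s\<in>{0<..<e}. k e - k 0 = p' ((z + a *\<^sub>R v) + (s - 0) *\<^sub>R w) w * (e - 0)"
    using mvt_simple[OF e, of k "\<lambda>s. (*) (p' ((z + a *\<^sub>R v) + (s - 0) *\<^sub>R w) w)"]
    by (auto simp: has_field_derivative_def)
  then obtain b where b: "b \<in> {0<..<e}" "k e - k 0 = p' (z + a *\<^sub>R v + b *\<^sub>R w) w * e"
    by auto
  have "h' a = k e - k 0" by (simp add: h'_def k_def algebra_simps)
  with a b have "h e - h 0 = e * e * p' (z + a *\<^sub>R v + b *\<^sub>R w) w" by simp
  moreover have "h e - h 0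
      = f (z + e *\<^sub>R v + e *\<^sub>R w) - f (z + e *\<^sub>R v) - f (z + e *\<^sub>R w) + f z"
    by (simp add: h_def algebra_simps)
  ultimately show ?thesis using a b
    by (intro bexI[of _ a] bexI[of _ b]) auto
qed

text \<open>The base point may lie on the boundary of \<open>D\<close>: only a quarter of a neighbourhood of it
  in the plane spanned by the two directions is required to lie in \<open>D\<close>.\<close>

lemma mixed_derivatives_commute:
  fixes f :: "'a::real_normed_vector \<Rightarrow> real"
  assumes D: "\<And>a b. a \<in> {0..e} \<Longrightarrow> b \<in> {0..e} \<Longrightarrow> z + a *\<^sub>R v + b *\<^sub>R w \<in> D"
    and f: "\<And>y. y \<in> D \<Longrightarrow> (f has_derivative f' y) (at y within D)"
    and p: "\<And>y. y \<in> D \<Longrightarrow> ((\<lambda>y. f' y v) has_derivative p' y) (at y within D)"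
    and q: "\<And>y. y \<in> D \<Longrightarrow> ((\<lambda>y. f' y w) has_derivative q' y) (at y within D)"
    and pc: "continuous_on D (\<lambda>y. p' y w)" and qc: "continuous_on D (\<lambda>y. q' y v)"
    and e: "0 < e"
  shows "p' z w = q' z v"
proof (rule ccontr)
  assume "p' z w \<noteq> q' z v"
  \<comment> \<open>Half the supposed gap: two errors below \<open>r\<close> cannot bridge
    it.\<close>
  define r where "r = \<bar>p' z w - q' z v\<bar> / 2"
  have r: "r > 0" using \<open>p' z w \<noteq> q' z v\<close> by (simp add: r_def)
  have z: "z \<in> D" using D[of 0 0] e by simp
  obtain d1 where d1: "d1 > 0" "\<And>y. y \<in> D \<Longrightarrow> dist y z < d1 \<Longrightarrow> dist (p' y w) (p' z w) < r"
    using pc z r unfolding continuous_on_iff by metis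
  obtain d2 where d2: "d2 > 0" "\<And>y. y \<in> D \<Longrightarrow> dist y z < d2 \<Longrightarrow> dist (q' y v) (q' z v) < r"
    using qc z r unfolding continuous_on_iff by metis
  define n where "n = norm v + norm w + 1"
  have n: "n > 0" by (simp add: n_def add_nonneg_pos)
  \<comment> \<open>A side length for which the parallelogram stays in \<open>D\<close> and so close
    to \<open>z\<close> that both continuity estimates apply; \<open>n\<close> bounds the
    displacement per unit of side length.\<close>
  define c where "c = min e (min d1 d2 / (2 * n))"
  have c: "0 < c" "c \<le> e" using e d1 d2 n by (auto simp: c_def)
  have "c * n \<le> min d1 d2 / (2 * n) * n" unfolding c_def using n by (intro mult_right_mono) auto
  also have "\<dots> = min d1 d2 / 2" using n by simp
  also have "\<dots> < min d1 d2" using d1 d2 by (simp add: min_def)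
  finally have cn: "c * n < min d1 d2" .
  have near: "dist (z + a *\<^sub>R v + b *\<^sub>R w) z < min d1 d2" if "a \<in> {0..c}" "b \<in> {0..c}" for a b
  proof -
    have "dist (z + a *\<^sub>R v + b *\<^sub>R w) z = norm (a *\<^sub>R v + b *\<^sub>R w)"
      by (simp add: dist_norm algebra_simps)
    also have "\<dots> \<le> a * norm v + b * norm w"
      using that norm_triangle_ineq[of "a *\<^sub>R v" "b *\<^sub>R w"] by simp
    also have "\<dots> \<le> c * norm v + c * norm w"
      using that by (intro add_mono mult_right_mono) auto
    also have "\<dots> \<le> c * n" using c by (simp add: n_def algebra_simps)
    finally show ?thesis using cn by simp
  qed
  obtain a b where ab: "a \<in> {0..c}" "b \<in> {0..c}"
      "f (z + c *\<^sub>R v + c *\<^sub>R w) - f (z + c *\<^sub>R v) - f (z + c *\<^sub>R w) + f z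
        = c * c * p' (z + a *\<^sub>R v + b *\<^sub>R w) w"
    using second_difference_mvt[of c z v w D f f' p'] D f p c by (auto 4 3)
  have "z + a *\<^sub>R w + b *\<^sub>R v \<in> D" if "a \<in> {0..c}" "b \<in> {0..c}" for a b
    using D[of b a] that c by (auto simp: add_ac)
  then obtain a' b' where ab': "a' \<in> {0..c}" "b' \<in> {0..c}"
      "f (z + c *\<^sub>R w + c *\<^sub>R v) - f (z + c *\<^sub>R w) - f (z + c *\<^sub>R v) + f z
        = c * c * q' (z + a' *\<^sub>R w + b' *\<^sub>R v) v"
    using second_difference_mvt[of c z w v D f f' q'] f q c by (auto 4 3)
  have swap: "z + s *\<^sub>R w + u *\<^sub>R v = z + u *\<^sub>R v + s *\<^sub>R w" for s u by (simp add: add_ac)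
  \<comment> \<open>The second difference is symmetric in \<open>v\<close> and \<open>w\<close>, so
    the two evaluations by the mean value theorem agree.\<close>
  have "c * c * p' (z + a *\<^sub>R v + b *\<^sub>R w) w = c * c * q' (z + b' *\<^sub>R v + a' *\<^sub>R w) v"
    using ab(3) ab'(3) unfolding swap by linarith
  then have "p' (z + a *\<^sub>R v + b *\<^sub>R w) w = q' (z + b' *\<^sub>R v + a' *\<^sub>R w) v" using c by simp
  moreover have "dist (p' (z + a *\<^sub>R v + b *\<^sub>R w) w) (p' z w) < r"
    using d1 near[OF ab(1,2)] D[of a b] ab c by auto
  moreover have "dist (q' (z + b' *\<^sub>R v + a' *\<^sub>R w) v) (q' z v) < r"
    using d2 near[OF ab'(2,1)] D[of b' a'] ab' c by auto
  moreover have "dist (p' z w) (q' z v) = r + r" by (simp add: r_def dist_real_def)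
  ultimately show False
    by (metis add_strict_mono dist_commute dist_triangle_half_r dist_triangle_lt less_irrefl)
qed

section \<open>Coordinate derivatives on space-time\<close>

text \<open>Every time, including 0, has room ahead of it. This makes one-sided time derivatives
  unique and leaves space for the second differences at t = 0.\<close>

lemma time_dom_forward:
  assumes "t \<in> time_dom T"
  obtains e where "0 < e" "{t..t + e} \<subseteq> time_dom T"
proof -
  have "ereal t < T" "0 \<le> t" using assms by (auto simp: time_dom_def)
  then obtain r where r: "t < r" "ereal r < T" using ereal_dense2 by fastforce
  have "s \<in> time_dom T" if "s \<in> {t..t + (r - t)}" for s
  proof -
    have "ereal s \<le> ereal r" using that by simp
    then have "ereal s < T" using r(2) by (rule order.strict_trans1)
    then show ?thesis using \<open>0 \<le> t\<close> that by (simp add: time_dom_def)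
  qed
  then have "{t..t + (r - t)} \<subseteq> time_dom T" by blast
  with r show ?thesis by (intro that[of "r - t"]) auto
qed

lemma at_within_time_dom_neq_bot:
  assumes "t \<in> time_dom T"
  shows "at t within time_dom T \<noteq> bot"
proof -
  obtain e where e: "0 < e" "{t..t + e} \<subseteq> time_dom T" using assms time_dom_forward by blast
  then have "at t within {t..t + e} \<noteq> bot" by (simp add: trivial_limit_within islimpt_Icc)
  then show ?thesis using at_le[OF e(2), of t] by (metis bot.extremum_uniqueI)
qed

primrec st_axis :: "'n::finite option \<Rightarrow> (real ^ 'n) \<times> real" where
  "st_axis None = (0, 1)"
| "st_axis (Some i) = (axis i 1, 0)"

section \<open>Coordinate derivatives as commuting derivations over one chart\<close>

locale st_domain =
  fixes U :: "(real ^ 'n::finite) set" and T :: ereal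
  assumes open_U: "open U"
begin

definition \<Omega> :: "((real ^ 'n) \<times> real) set" where "\<Omega> = U \<times> time_dom T"

text \<open>\<open>pd\<close> is defined through the choice operator
  \<open>vector_derivative\<close>. Its value is pinned down by uniqueness of derivatives: in time
  because the filter within \<open>time_dom T\<close> is nontrivial, in space because
  \<open>U\<close> is open.\<close>

lemma pd_eq:
  assumes z: "z \<in> \<Omega>" and f: "(f has_derivative f') (at z within \<Omega>)"
  shows "pd T i f z = f' (st_axis i)"
    and "i = None \<Longrightarrow> ((\<lambda>s. f (fst z, s)) has_real_derivative f' (st_axis i)) (at (snd z) within time_dom T)"
proof -
  obtain x t where xt: "z = (x, t)" "x \<in> U" "t \<in> time_dom T" using z by (auto simp: \<Omega>_def)
  have time: "((\<lambda>s. f (x, s)) has_real_derivative f' (0, 1)) (at t within time_dom T)"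
    using has_real_derivative_along_line[of f f' "(x, t)" t t "(0, 1)" \<Omega> "time_dom T"] f xt
    by (auto simp: \<Omega>_def)
  show "pd T i f z = f' (st_axis i)"
  proof (cases i)
    case None
    then show ?thesis using time xt at_within_time_dom_neq_bot
      by (auto simp: has_real_derivative_iff_has_vector_derivative intro!: vector_derivative_within)
  next
    case (Some k)
    \<comment> \<open>The parameters for which the coordinate line stays in \<open>U\<close>. As
      \<open>J\<close> is open, the derivative within it is the two-sided one of
      \<open>spatial_pd\<close>.\<close>
    define J where "J = (\<lambda>s::real. x + s *\<^sub>R axis k 1) -` U"
    have J: "open J"
      unfolding J_def by (intro open_vimage open_U continuous_intros)
    have "0 \<in> J" using xt by (simp add: J_def)
    have "((\<lambda>s. f ((x, t) + (s - 0) *\<^sub>R (axis k 1, 0))) has_real_derivative f' (axis k 1, 0)) (at 0 within J)"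
      by (rule has_real_derivative_along_line[where D = \<Omega>])
        (use f xt in \<open>auto simp: \<Omega>_def J_def\<close>)
    then have "((\<lambda>s. f (x + s *\<^sub>R axis k 1, t)) has_real_derivative f' (axis k 1, 0)) (at 0)"
      using at_within_open[OF \<open>0 \<in> J\<close> J] by simp
    then show ?thesis using Some xt
      by (auto simp: spatial_pd_def has_real_derivative_iff_has_vector_derivative
          intro!: vector_derivative_at)
  qed
  show "((\<lambda>s. f (fst z, s)) has_real_derivative f' (st_axis i)) (at (snd z) within time_dom T)"
    if "i = None" using time xt that by simp
qed

text \<open>Fields are total functions about which nothing is known outside \<open>\<Omega>\<close>.
  This allows an identity that holds only on \<open>\<Omega>\<close> to be differentiated; in
  spatial directions agreement near the point suffices.\<close>

lemma pd_cong:
  assumes z: "z \<in> \<Omega>" and fg: "\<And>y. y \<in> \<Omega> \<Longrightarrow> f y = g y"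
  shows "pd T i f z = pd T i g z"
proof -
  obtain x t where xt: "z = (x, t)" "x \<in> U" "t \<in> time_dom T" using z by (auto simp: \<Omega>_def)
  show ?thesis
  proof (cases i)
    case None
    have "((\<lambda>s. f (x, s)) has_vector_derivative d) (at t within time_dom T)
        \<longleftrightarrow> ((\<lambda>s. g (x, s)) has_vector_derivative d) (at t within time_dom T)" for d
      by (intro has_vector_derivative_cong_ev always_eventually) (use xt fg in \<open>auto simp: \<Omega>_def\<close>)
    then show ?thesis using None xt by (simp add: vector_derivative_def)
  next
    case (Some k)
    define J where "J = (\<lambda>s::real. x + s *\<^sub>R axis k 1) -` U"
    have "open J"
      unfolding J_def by (intro open_vimage open_U continuous_intros)
    moreover have "0 \<in> J" using xt by (simp add: J_def)
    ultimately have "\<forall>\<^sub>F s in nhds 0. s \<in> J" using eventually_nhds by blast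
    then have "\<forall>\<^sub>F s in nhds 0. s \<in> UNIV \<longrightarrow> f (x + s *\<^sub>R axis k 1, t) = g (x + s *\<^sub>R axis k 1, t)"
      by eventually_elim (use xt fg in \<open>auto simp: J_def \<Omega>_def\<close>)
    then have "((\<lambda>s. f (x + s *\<^sub>R axis k 1, t)) has_vector_derivative d) (at 0)
        \<longleftrightarrow> ((\<lambda>s. g (x + s *\<^sub>R axis k 1, t)) has_vector_derivative d) (at 0)" for d
      by (intro has_vector_derivative_cong_ev) (use xt fg in \<open>auto simp: \<Omega>_def\<close>)
    then show ?thesis using Some xt by (simp add: spatial_pd_def vector_derivative_def)
  qed
qed

definition S :: "'n field set" where "S = {f. smooth_on \<Omega> f}"

lemma smooth_has_derivative:
  assumes "f \<in> S"
  shows "\<exists>f'. \<forall>z\<in>\<Omega>. (f has_derivative f' z) (at z within \<Omega>)"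
proof -
  have "Ck_on (Suc 0) \<Omega> f" using assms by (simp only: S_def smooth_on_def mem_Collect_eq)
  then show ?thesis by auto
qed

lemma pd_const: "z \<in> \<Omega> \<Longrightarrow> pd T i (\<lambda>z. c) z = 0"
  using pd_eq(1)[of z "\<lambda>z. c" "\<lambda>h. 0"] by simp

lemma pd_add:
  assumes "f \<in> S" "g \<in> S" "z \<in> \<Omega>"
  shows "pd T i (\<lambda>z. f z + g z) z = pd T i f z + pd T i g z"
proof -
  obtain f' where "\<forall>z\<in>\<Omega>. (f has_derivative f' z) (at z within \<Omega>)"
    using smooth_has_derivative[OF assms(1)] by (rule exE)
  with assms(3) have f: "(f has_derivative f' z) (at z within \<Omega>)" by (rule bspec[rotated])
  obtain g' where "\<forall>z\<in>\<Omega>. (g has_derivative g' z) (at z within \<Omega>)"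
    using smooth_has_derivative[OF assms(2)] by (rule exE)
  with assms(3) have g: "(g has_derivative g' z) (at z within \<Omega>)" by (rule bspec[rotated])
  show ?thesis
    using pd_eq(1)[OF assms(3) has_derivative_add[OF f g]] pd_eq(1)[OF assms(3) f] pd_eq(1)[OF assms(3) g]
    by simp
qed

lemma pd_mult:
  assumes "f \<in> S" "g \<in> S" "z \<in> \<Omega>"
  shows "pd T i (\<lambda>z. f z * g z) z = f z * pd T i g z + pd T i f z * g z"
proof -
  obtain f' where "\<forall>z\<in>\<Omega>. (f has_derivative f' z) (at z within \<Omega>)"
    using smooth_has_derivative[OF assms(1)] by (rule exE)
  with assms(3) have f: "(f has_derivative f' z) (at z within \<Omega>)" by (rule bspec[rotated])
  obtain g' where "\<forall>z\<in>\<Omega>. (g has_derivative g' z) (at z within \<Omega>)"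
    using smooth_has_derivative[OF assms(2)] by (rule exE)
  with assms(3) have g: "(g has_derivative g' z) (at z within \<Omega>)" by (rule bspec[rotated])
  show ?thesis
    using pd_eq(1)[OF assms(3) has_derivative_mult[OF f g]] pd_eq(1)[OF assms(3) f] pd_eq(1)[OF assms(3) g]
    by simp
qed

lemma pd_smooth:
  assumes "f \<in> S"
  shows "pd T i f \<in> S"
proof -
  have "Ck_on k \<Omega> (pd T i f)" for k
  proof -
    have "Ck_on (Suc k) \<Omega> f" using assms by (simp only: S_def smooth_on_def mem_Collect_eq)
    then obtain f' where f': "\<forall>z\<in>\<Omega>. (f has_derivative f' z) (at z within \<Omega>)"
      "\<forall>v. Ck_on k \<Omega> (\<lambda>z. f' z v)" by auto
    show ?thesis
    proof (rule Ck_on_cong)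
      show "f' z (st_axis i) = pd T i f z" if "z \<in> \<Omega>" for z
        using pd_eq(1)[OF that bspec[OF f'(1) that], of i] by simp
      show "Ck_on k \<Omega> (\<lambda>z. f' z (st_axis i))" using f'(2) ..
    qed
  qed
  then show ?thesis by (simp add: S_def smooth_on_def)
qed

text \<open>\<open>pd\<close> alone gives only a value; this supplies the existence of the time
  derivative, as the final statement demands.\<close>

lemma has_real_derivative_pd_None:
  assumes "f \<in> S" "x \<in> U" "t \<in> time_dom T"
  shows "((\<lambda>s. f (x, s)) has_real_derivative pd T None f (x, t)) (at t within time_dom T)"
proof -
  have z: "(x, t) \<in> \<Omega>" using assms by (simp add: \<Omega>_def)
  obtain f' where f': "\<forall>z\<in>\<Omega>. (f has_derivative f' z) (at z within \<Omega>)"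
    using smooth_has_derivative[OF assms(1)] by (rule exE)
  show ?thesis using pd_eq[OF z bspec[OF f' z], of None] by simp
qed

text \<open>Both axis vectors have a nonnegative time component, so the quarter neighbourhood needed
  for the symmetry lies in \<open>\<Omega>\<close> even at t = 0.\<close>

lemma pd_commute:
  assumes f: "f \<in> S" and z: "z \<in> \<Omega>"
  shows "pd T i (pd T j f) z = pd T j (pd T i f) z"
proof -
  obtain x t where xt: "z = (x, t)" "x \<in> U" "t \<in> time_dom T" using z by (auto simp: \<Omega>_def)
  let ?v = "st_axis j :: (real ^ 'n) \<times> real" and ?w = "st_axis i :: (real ^ 'n) \<times> real"
  obtain e1 where e1: "0 < e1" "cball x e1 \<subseteq> U" using open_U xt open_contains_cball by metis
  obtain e2 where e2: "0 < e2" "{t..t + e2} \<subseteq> time_dom T" using xt time_dom_forward by metis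
  \<comment> \<open>Halved because both steps may go in the same direction, with a total
    displacement of up to 2e.\<close>
  define e where "e = min e1 e2 / 2"
  have e: "0 < e" "2 * e \<le> e1" "2 * e \<le> e2" using e1 e2 by (auto simp: e_def)
  have D: "z + a *\<^sub>R ?v + b *\<^sub>R ?w \<in> \<Omega>" if "a \<in> {0..e}" "b \<in> {0..e}" for a b
  proof -
    have fst: "norm (fst (st_axis k :: (real ^ 'n) \<times> real)) \<le> 1" for k by (cases k) auto
    have snd: "snd (st_axis k :: (real ^ 'n) \<times> real) \<in> {0..1}" for k by (cases k) auto
    have "norm (a *\<^sub>R fst ?v + b *\<^sub>R fst ?w) \<le> a * norm (fst ?v) + b * norm (fst ?w)"
      using that norm_triangle_ineq[of "a *\<^sub>R fst ?v" "b *\<^sub>R fst ?w"] by simp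
    also have "\<dots> \<le> e * 1 + e * 1" using that fst by (intro add_mono mult_mono) auto
    finally have 1: "x + a *\<^sub>R fst ?v + b *\<^sub>R fst ?w \<in> U"
      using e e1(2) by (auto simp: subset_iff dist_norm norm_minus_commute add.assoc)
    have "a * snd ?v + b * snd ?w \<le> e * 1 + e * 1"
      using that snd e by (intro add_mono mult_mono) auto
    moreover have "0 \<le> a * snd ?v + b * snd ?w" using that snd by auto
    ultimately have "t + a * snd ?v + b * snd ?w \<in> {t..t + e2}" using e by auto
    with 1 e2 show ?thesis unfolding \<Omega>_def xt(1) by (auto simp: mem_Times_iff)
  qed
  obtain f' where f': "\<forall>y\<in>\<Omega>. (f has_derivative f' y) (at y within \<Omega>)"
    using smooth_has_derivative[OF f] by (rule exE)
  have pd: "pd T k f y = f' y (st_axis k)" if "y \<in> \<Omega>" for y k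
    using pd_eq(1)[OF that bspec[OF f' that]] .
  have second: "\<exists>p'. (\<forall>y\<in>\<Omega>. ((\<lambda>y. f' y (st_axis k)) has_derivative p' y) (at y within \<Omega>)) \<and>
      (\<forall>l. continuous_on \<Omega> (\<lambda>y. p' y (st_axis l)) \<and> pd T l (pd T k f) z = p' z (st_axis l))" for k
  proof -
    obtain p' where p': "\<forall>y\<in>\<Omega>. (pd T k f has_derivative p' y) (at y within \<Omega>)"
      using smooth_has_derivative[OF pd_smooth[OF f]] by (rule exE)
    have pd2: "pd T l (pd T k f) y = p' y (st_axis l)" if "y \<in> \<Omega>" for l y
      using pd_eq(1)[OF that bspec[OF p' that]] .
    have cont: "continuous_on \<Omega> (pd T l (pd T k f))" for l
    proof -
      have "Ck_on 0 \<Omega> (pd T l (pd T k f))"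
        using pd_smooth[OF pd_smooth[OF f]] unfolding S_def smooth_on_def by blast
      then show ?thesis by simp
    qed
    have "((\<lambda>y. f' y (st_axis k)) has_derivative p' y) (at y within \<Omega>)" if "y \<in> \<Omega>" for y
      by (rule has_derivative_transform[OF that _ bspec[OF p' that]]) (simp add: pd)
    moreover have "continuous_on \<Omega> (\<lambda>y. p' y (st_axis l))" for l
      using cont[of l] by (rule continuous_on_eq) (rule pd2)
    ultimately show ?thesis using pd2[OF z] by (intro exI[of _ p']) simp
  qed
  obtain p' where p': "\<forall>y\<in>\<Omega>. ((\<lambda>y. f' y ?v) has_derivative p' y) (at y within \<Omega>)"
      "\<forall>l. continuous_on \<Omega> (\<lambda>y. p' y (st_axis l)) \<and> pd T l (pd T j f) z = p' z (st_axis l)"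
    using second[of j] by auto
  obtain q' where q': "\<forall>y\<in>\<Omega>. ((\<lambda>y. f' y ?w) has_derivative q' y) (at y within \<Omega>)"
      "\<forall>l. continuous_on \<Omega> (\<lambda>y. q' y (st_axis l)) \<and> pd T l (pd T i f) z = q' z (st_axis l)"
    using second[of i] by auto
  have "p' z ?w = q' z ?v"
    by (rule mixed_derivatives_commute[where e = e and D = \<Omega> and f = f and f' = f'])
      (use D f' p' q' e in auto)
  then show ?thesis using p' q' by simp
qed

end

section \<open>Torsion-free connections\<close>

text \<open>An algebra of functions with commuting derivations. The index type is left open, so that
  one tensor calculus serves both M and space-time; equations are asserted on
  \<open>\<Omega>\<close> only.\<close>

locale derivations =
  fixes \<Omega> :: "'p set" and S :: "('p \<Rightarrow> real) set" and D :: "'k::finite \<Rightarrow> ('p \<Rightarrow> real) \<Rightarrow> 'p \<Rightarrow> real"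
  assumes S_const: "(\<lambda>z. c) \<in> S"
    and S_add: "f \<in> S \<Longrightarrow> h \<in> S \<Longrightarrow> (\<lambda>z. f z + h z) \<in> S"
    and S_mult: "f \<in> S \<Longrightarrow> h \<in> S \<Longrightarrow> (\<lambda>z. f z * h z) \<in> S"
    and S_D: "f \<in> S \<Longrightarrow> D i f \<in> S"
    and D_cong: "z \<in> \<Omega> \<Longrightarrow> (\<And>y. y \<in> \<Omega> \<Longrightarrow> f y = h y) \<Longrightarrow> D i f z = D i h z"
    and D_const: "z \<in> \<Omega> \<Longrightarrow> D i (\<lambda>z. c) z = 0"
    and D_add: "f \<in> S \<Longrightarrow> h \<in> S \<Longrightarrow> z \<in> \<Omega> \<Longrightarrow> D i (\<lambda>z. f z + h z) z = D i f z + D i h z"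
    and D_mult: "f \<in> S \<Longrightarrow> h \<in> S \<Longrightarrow> z \<in> \<Omega> \<Longrightarrow>
        D i (\<lambda>z. f z * h z) z = f z * D i h z + D i f z * h z"
    and D_commute: "f \<in> S \<Longrightarrow> z \<in> \<Omega> \<Longrightarrow> D i (D j f) z = D j (D i f) z"
begin

lemma S_minus: "f \<in> S \<Longrightarrow> (\<lambda>z. - f z) \<in> S"
  using S_mult[OF S_const[of "-1"], of f] by simp

lemma S_diff: "f \<in> S \<Longrightarrow> h \<in> S \<Longrightarrow> (\<lambda>z. f z - h z) \<in> S"
  using S_add[OF _ S_minus, of f h] by simp

lemma S_sum: "(\<And>p. p \<in> K \<Longrightarrow> f p \<in> S) \<Longrightarrow> (\<lambda>z. \<Sum>p\<in>K. f p z) \<in> S"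
  by (induction K rule: infinite_finite_induct) (auto intro: S_const S_add)

lemmas S_intros = S_const S_add S_mult S_D S_minus S_diff S_sum

lemma D_minus: "f \<in> S \<Longrightarrow> z \<in> \<Omega> \<Longrightarrow> D i (\<lambda>z. - f z) z = - D i f z"
  using D_mult[OF S_const[of "-1"], of f z] D_const by simp

lemma D_diff: "f \<in> S \<Longrightarrow> h \<in> S \<Longrightarrow> z \<in> \<Omega> \<Longrightarrow> D i (\<lambda>z. f z - h z) z = D i f z - D i h z"
  using D_add[OF _ S_minus, of f h z i] D_minus[of h z i] by simp

lemma D_sum: "(\<And>p. p \<in> K \<Longrightarrow> f p \<in> S) \<Longrightarrow> z \<in> \<Omega> \<Longrightarrow>
    D i (\<lambda>z. \<Sum>p\<in>K. f p z) z = (\<Sum>p\<in>K. D i (f p) z)"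
  by (induction K rule: infinite_finite_induct) (auto simp: D_const D_add S_sum)

lemmas D_rules = D_const D_add D_mult D_minus D_diff D_sum

end

section \<open>Curvature of a torsion-free connection, without a metric\<close>

locale connection = derivations \<Omega> S D
  for \<Omega> :: "'p set" and S :: "('p \<Rightarrow> real) set" and D :: "'k::finite \<Rightarrow> ('p \<Rightarrow> real) \<Rightarrow> 'p \<Rightarrow> real" +
  fixes \<Gamma> :: "'k \<Rightarrow> 'k \<Rightarrow> 'k \<Rightarrow> 'p \<Rightarrow> real"
  assumes \<Gamma>_S: "\<Gamma> l i k \<in> S"
    and \<Gamma>_sym: "z \<in> \<Omega> \<Longrightarrow> \<Gamma> l i k z = \<Gamma> l k i z"
begin

abbreviation "R \<equiv> curvature D \<Gamma>"

lemma R_S: "R l i j k \<in> S"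
proof -
  have "R l i j k = (\<lambda>z. R l i j k z)" by simp
  then show ?thesis unfolding curvature_def by (auto intro!: S_intros \<Gamma>_S)
qed

lemma ricci_S: "ricci D \<Gamma> j k \<in> S"
proof -
  have "ricci D \<Gamma> j k = (\<lambda>z. \<Sum>p\<in>UNIV. R p p j k z)" by (auto simp: ricci_def)
  then show ?thesis by (auto intro!: S_intros R_S)
qed

lemma R_antisym: "R l j i k z = - R l i j k z"
  by (simp add: curvature_def)

lemma D_R:
  assumes z: "z \<in> \<Omega>"
  shows "D m (R l i j k) z = D m (D i (\<Gamma> l j k)) z - D m (D j (\<Gamma> l i k)) z
    + (\<Sum>p\<in>UNIV. \<Gamma> p j k z * D m (\<Gamma> l i p) z + D m (\<Gamma> p j k) z * \<Gamma> l i p z)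
    - (\<Sum>p\<in>UNIV. \<Gamma> p i k z * D m (\<Gamma> l j p) z + D m (\<Gamma> p i k) z * \<Gamma> l j p z)"
proof -
  have "R l i j k = (\<lambda>z. D i (\<Gamma> l j k) z - D j (\<Gamma> l i k) z
     + (\<Sum>p\<in>UNIV. \<Gamma> p j k z * \<Gamma> l i p z) - (\<Sum>p\<in>UNIV. \<Gamma> p i k z * \<Gamma> l j p z))"
    by (auto simp: curvature_def)
  then show ?thesis using z by (simp add: D_rules S_intros \<Gamma>_S)
qed

text \<open>The second Bianchi identity for the connection on the bundle only; the terms in which the
  connection acts on the form indices \<open>m, i, j\<close> cancel in the cyclic sum by torsion-freeness.\<close>

lemma bianchi:
  fixes l k
  assumes z: "z \<in> \<Omega>"
  defines "E \<equiv> \<lambda>m i j. D m (R l i j k) z + (\<Sum>p\<in>UNIV. \<Gamma> l m p z * R p i j k z)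
      - (\<Sum>p\<in>UNIV. R l i j p z * \<Gamma> p m k z)"
  shows "E m i j + E i j m + E j m i = 0"
proof -
  \<comment> \<open>The terms cubic in \<Gamma>. In the cyclic sum each of them occurs once with
    either sign, and the second derivatives of \<Gamma> cancel because the derivations
    commute.\<close>
  define C where "C a b c = (\<Sum>p\<in>UNIV. \<Sum>q\<in>UNIV. \<Gamma> l a p z * \<Gamma> p b q z * \<Gamma> q c k z)" for a b c
  have left: "(\<Sum>p\<in>UNIV. \<Gamma> l m p z * R p i j k z)
      = (\<Sum>p\<in>UNIV. \<Gamma> l m p z * D i (\<Gamma> p j k) z) - (\<Sum>p\<in>UNIV. \<Gamma> l m p z * D j (\<Gamma> p i k) z)
        + C m i j - C m j i" for m i j
    unfolding curvature_def C_def
    by (simp add: distrib_left right_diff_distrib sum.distrib sum_subtractf sum_distrib_left mult_ac)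
  have right: "(\<Sum>p\<in>UNIV. R l i j p z * \<Gamma> p m k z)
      = (\<Sum>p\<in>UNIV. D i (\<Gamma> l j p) z * \<Gamma> p m k z) - (\<Sum>p\<in>UNIV. D j (\<Gamma> l i p) z * \<Gamma> p m k z)
        + C i j m - C j i m" for m i j
  proof -
    have "C a b c = (\<Sum>q\<in>UNIV. \<Sum>p\<in>UNIV. \<Gamma> p b q z * \<Gamma> l a p z * \<Gamma> q c k z)" for a b c
      unfolding C_def by (subst sum.swap) (simp add: mult_ac)
    then show ?thesis unfolding curvature_def
      by (simp add: distrib_right left_diff_distrib sum.distrib sum_subtractf sum_distrib_right)
  qed
  have comm: "D a (D b (\<Gamma> l c k)) z = D b (D a (\<Gamma> l c k)) z" for a b c
    using D_commute \<Gamma>_S z by blast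
  show ?thesis
    unfolding E_def left right D_R[OF z]
    using comm[of m i j] comm[of m j i] comm[of i j m]
    by (simp add: sum.distrib mult.commute)
qed

text \<open>The trace of the commutator of second covariant derivatives of \<open>X\<close>: the
  divergence of \<nabla>X minus the gradient of the divergence of \<open>X\<close>. Second
  derivatives of \<open>X\<close> commute and first derivatives cancel by torsion-freeness, so only
  curvature is left.\<close>

lemma contracted_ricci_identity:
  fixes X
  assumes z: "z \<in> \<Omega>" and X: "\<And>k. X k \<in> S"
  defines "N \<equiv> \<lambda>k i. cov_vector D \<Gamma> X i k"
  shows "(\<Sum>p\<in>UNIV. D p (N p j) z) + (\<Sum>p\<in>UNIV. \<Sum>q\<in>UNIV. \<Gamma> p p q z * N q j z)
      - (\<Sum>p\<in>UNIV. \<Sum>q\<in>UNIV. \<Gamma> q p j z * N p q z) - D j (\<lambda>y. \<Sum>p\<in>UNIV. N p p y) z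
    = (\<Sum>q\<in>UNIV. ricci D \<Gamma> j q z * X q z)"
proof -
  have N: "N k i = (\<lambda>z. D i (X k) z + (\<Sum>q\<in>UNIV. \<Gamma> k i q z * X q z))" for k i
    by (auto simp: N_def cov_vector_def)
  have dN: "D a (N k i) z = D a (D i (X k)) z + (\<Sum>q\<in>UNIV. \<Gamma> k i q z * D a (X q) z)
       + (\<Sum>q\<in>UNIV. D a (\<Gamma> k i q) z * X q z)" for a k i
    unfolding N using z by (simp add: D_rules S_intros \<Gamma>_S X sum.distrib)
  have dtr: "D j (\<lambda>y. \<Sum>p\<in>UNIV. N p p y) z = (\<Sum>p\<in>UNIV. D j (N p p) z)"
    using z by (intro D_sum) (auto simp: N intro!: S_intros \<Gamma>_S X)
  have ric: "(\<Sum>q\<in>UNIV. ricci D \<Gamma> j q z * X q z) =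
      (\<Sum>p\<in>UNIV. \<Sum>q\<in>UNIV. D p (\<Gamma> p j q) z * X q z) - (\<Sum>p\<in>UNIV. \<Sum>q\<in>UNIV. D j (\<Gamma> p p q) z * X q z)
      + (\<Sum>p\<in>UNIV. \<Sum>q\<in>UNIV. \<Sum>r\<in>UNIV. \<Gamma> p p q z * \<Gamma> q j r z * X r z)
      - (\<Sum>p\<in>UNIV. \<Sum>q\<in>UNIV. \<Sum>r\<in>UNIV. \<Gamma> p j q z * \<Gamma> q p r z * X r z)"
  proof -
    have swap: "(\<Sum>p\<in>UNIV. \<Sum>r\<in>UNIV. \<Sum>q\<in>UNIV. a p r q) = (\<Sum>p\<in>UNIV. \<Sum>q\<in>UNIV. \<Sum>r\<in>UNIV. a p r q)"
      for a :: "'k \<Rightarrow> 'k \<Rightarrow> 'k \<Rightarrow> real"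
      by (intro sum.cong refl sum.swap)
    have "(\<Sum>q\<in>UNIV. ricci D \<Gamma> j q z * X q z) = (\<Sum>p\<in>UNIV. \<Sum>r\<in>UNIV. R p p j r z * X r z)"
      unfolding ricci_def by (subst sum.swap) (simp add: sum_distrib_right)
    also have "\<dots> = (\<Sum>p\<in>UNIV. \<Sum>q\<in>UNIV. D p (\<Gamma> p j q) z * X q z)
      - (\<Sum>p\<in>UNIV. \<Sum>q\<in>UNIV. D j (\<Gamma> p p q) z * X q z)
      + (\<Sum>p\<in>UNIV. \<Sum>r\<in>UNIV. \<Sum>q\<in>UNIV. \<Gamma> p p q z * \<Gamma> q j r z * X r z)
      - (\<Sum>p\<in>UNIV. \<Sum>r\<in>UNIV. \<Sum>q\<in>UNIV. \<Gamma> p j q z * \<Gamma> q p r z * X r z)"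
      unfolding curvature_def
      by (simp add: algebra_simps sum.distrib sum_subtractf sum_distrib_left)
    finally show ?thesis
      using swap[of "\<lambda>p r q. \<Gamma> p p q z * \<Gamma> q j r z * X r z"]
        swap[of "\<lambda>p r q. \<Gamma> p j q z * \<Gamma> q p r z * X r z"] by simp
  qed
  have "(\<Sum>p\<in>UNIV. \<Sum>q\<in>UNIV. \<Gamma> p p q z * N q j z) = (\<Sum>p\<in>UNIV. \<Sum>q\<in>UNIV. \<Gamma> p p q z * D j (X q) z)
      + (\<Sum>p\<in>UNIV. \<Sum>q\<in>UNIV. \<Sum>r\<in>UNIV. \<Gamma> p p q z * \<Gamma> q j r z * X r z)"
    unfolding N by (simp add: distrib_left sum.distrib sum_distrib_left mult_ac)
  moreover have "(\<Sum>p\<in>UNIV. \<Sum>q\<in>UNIV. \<Gamma> q p j z * N p q z)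
      = (\<Sum>p\<in>UNIV. \<Sum>q\<in>UNIV. \<Gamma> p j q z * D p (X q) z)
      + (\<Sum>p\<in>UNIV. \<Sum>q\<in>UNIV. \<Sum>r\<in>UNIV. \<Gamma> p j q z * \<Gamma> q p r z * X r z)"
  proof -
    have "(\<Sum>p\<in>UNIV. \<Sum>q\<in>UNIV. \<Gamma> q p j z * N p q z) = (\<Sum>q\<in>UNIV. \<Sum>p\<in>UNIV. \<Gamma> q j p z * N p q z)"
      by (subst sum.swap) (simp add: \<Gamma>_sym[OF z, of _ _ j])
    then show ?thesis
      unfolding N by (simp add: distrib_left sum.distrib sum_distrib_left mult_ac)
  qed
  ultimately show ?thesis
    unfolding dtr dN ric using D_commute[OF X z, of _ j]
    by (simp add: sum.distrib)
qed

text \<open>The terms quadratic in \<Gamma> are symmetric, so the skew part of Ricci is an exterior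
  derivative of the traced connection coefficients.\<close>

lemma ricci_skew:
  assumes z: "z \<in> \<Omega>"
  shows "ricci D \<Gamma> j k z - ricci D \<Gamma> k j z
    = D k (\<lambda>y. \<Sum>p\<in>UNIV. \<Gamma> p p j y) z - D j (\<lambda>y. \<Sum>p\<in>UNIV. \<Gamma> p p k y) z"
proof -
  have ric: "ricci D \<Gamma> j k z = (\<Sum>p\<in>UNIV. D p (\<Gamma> p j k) z) - D j (\<lambda>y. \<Sum>p\<in>UNIV. \<Gamma> p p k y) z
      + (\<Sum>p\<in>UNIV. \<Sum>q\<in>UNIV. \<Gamma> q j k z * \<Gamma> p p q z)
      - (\<Sum>p\<in>UNIV. \<Sum>q\<in>UNIV. \<Gamma> q p k z * \<Gamma> p j q z)" for j k
    unfolding ricci_def curvature_def using z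
    by (simp add: D_sum \<Gamma>_S sum.distrib sum_subtractf)
  have "D p (\<Gamma> p j k) z = D p (\<Gamma> p k j) z" for p
    by (rule D_cong[OF z]) (rule \<Gamma>_sym)
  moreover have "(\<Sum>p\<in>UNIV. \<Sum>q\<in>UNIV. \<Gamma> q p k z * \<Gamma> p j q z) = (\<Sum>p\<in>UNIV. \<Sum>q\<in>UNIV. \<Gamma> q p j z * \<Gamma> p k q z)"
    by (subst sum.swap) (simp add: \<Gamma>_sym[OF z, of _ j] \<Gamma>_sym[OF z, of _ k] mult.commute)
  ultimately show ?thesis unfolding ric using \<Gamma>_sym[OF z, of _ j k] by simp
qed

text \<open>The connection terms carrying the index pairs (i,l) and (j,l) cancel in pairs, as in the
  derivation of the Christoffel symbols from metric compatibility; only the pair (i,j) survives,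
  twice.\<close>

lemma cov_bilinear_christoffel:
  assumes z: "z \<in> \<Omega>" and B: "\<And>i j. B i j z = B j i z"
  shows "- cov_bilinear D \<Gamma> B i j l z - cov_bilinear D \<Gamma> B j i l z + cov_bilinear D \<Gamma> B l i j z
    = - D i (B j l) z - D j (B i l) z + D l (B i j) z + 2 * (\<Sum>p\<in>UNIV. \<Gamma> p i j z * B p l z)"
  unfolding cov_bilinear_def
  using B \<Gamma>_sym[OF z, of _ j i] \<Gamma>_sym[OF z, of _ l i] \<Gamma>_sym[OF z, of _ l j] by simp

end

section \<open>Curvature identities for a parallel, possibly degenerate metric given with upper
  indices\<close>

locale compatible_connection = connection \<Omega> S D \<Gamma>
  for \<Omega> :: "'p set" and S :: "('p \<Rightarrow> real) set" and D :: "'k::finite \<Rightarrow> ('p \<Rightarrow> real) \<Rightarrow> 'p \<Rightarrow> real"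
    and \<Gamma> :: "'k \<Rightarrow> 'k \<Rightarrow> 'k \<Rightarrow> 'p \<Rightarrow> real" +
  fixes H :: "'k \<Rightarrow> 'k \<Rightarrow> 'p \<Rightarrow> real"
  assumes H_S: "H i j \<in> S"
    and H_sym: "z \<in> \<Omega> \<Longrightarrow> H i j z = H j i z"
    and compatible: "z \<in> \<Omega> \<Longrightarrow>
      D i (H j k) z = - (\<Sum>p\<in>UNIV. \<Gamma> j i p z * H p k z) - (\<Sum>p\<in>UNIV. \<Gamma> k i p z * H j p z)"
begin

text \<open>The curvature with its last lower index raised. For degenerate \<open>H\<close> no index
  can be lowered, so the metric symmetries of curvature are expressed with two upper
  indices.\<close>

definition K :: "'k \<Rightarrow> 'k \<Rightarrow> 'k \<Rightarrow> 'k \<Rightarrow> 'p \<Rightarrow> real" where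
  "K l n i j z = (\<Sum>k\<in>UNIV. R l i j k z * H k n z)"

definition ricci_up :: "'k \<Rightarrow> 'k \<Rightarrow> 'p \<Rightarrow> real" where
  "ricci_up l i z = raise H (ricci D \<Gamma> i) l z"

lemma K_S: "K l n i j \<in> S"
proof -
  have "K l n i j = (\<lambda>z. \<Sum>k\<in>UNIV. R l i j k z * H k n z)" by (auto simp: K_def)
  then show ?thesis by (auto intro!: S_intros R_S H_S)
qed

lemma K_antisym_form: "K l n j i z = - K l n i j z"
  unfolding K_def by (simp add: R_antisym[of _ j i] sum_negf)

text \<open>The Ricci identity for the parallel tensor \<open>H\<close>: compatibility is
  substituted twice into the equality of the mixed second derivatives of \<open>H\<close>.\<close>

lemma K_antisym:
  assumes z: "z \<in> \<Omega>"
  shows "K n l i j z = - K l n i j z"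
proof -
  \<comment> \<open>In \<open>P\<close> both connection coefficients act on one index of
    \<open>H\<close>, in \<open>Q\<close> one acts on each. The \<open>Q\<close> terms are symmetric
    and drop out; the \<open>P\<close> terms complete the curvature.\<close>
  define P where "P l n i j = (\<Sum>p\<in>UNIV. \<Sum>q\<in>UNIV. \<Gamma> l i p z * \<Gamma> p j q z * H q n z)" for l n i j
  define Q where "Q l n i j = (\<Sum>p\<in>UNIV. \<Sum>q\<in>UNIV. \<Gamma> l i p z * \<Gamma> n j q z * H p q z)" for l n i j
  have Q: "Q l n i j = Q n l j i" for l n i j
    unfolding Q_def by (subst sum.swap) (simp add: H_sym[OF z] mult_ac)
  have K: "K l n i j z = (\<Sum>p\<in>UNIV. D i (\<Gamma> l j p) z * H p n z) - (\<Sum>p\<in>UNIV. D j (\<Gamma> l i p) z * H p n z)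
      + P l n i j - P l n j i" for l n i j
  proof -
    have "P l n i j = (\<Sum>q\<in>UNIV. \<Sum>p\<in>UNIV. \<Gamma> p j q z * \<Gamma> l i p z * H q n z)" for l n i j
      unfolding P_def by (subst sum.swap) (simp add: mult_ac)
    then show ?thesis unfolding K_def curvature_def
      by (simp add: distrib_right left_diff_distrib sum.distrib sum_subtractf sum_distrib_right)
  qed
  have DD: "D i (D j (H l n)) z = - (\<Sum>p\<in>UNIV. D i (\<Gamma> l j p) z * H p n z)
      - (\<Sum>p\<in>UNIV. D i (\<Gamma> n j p) z * H p l z) + P l n j i + Q l n j i + P n l j i + Q n l j i"
    for i j
  proof -
    have sub: "(\<Sum>p\<in>UNIV. \<Gamma> l j p z * D i (H p n) z) = - P l n j i - Q l n j i" for l n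
      unfolding P_def Q_def compatible[OF z]
      by (simp add: right_diff_distrib sum_subtractf sum_negf sum_distrib_left mult_ac)
    have "D i (D j (H l n)) z
        = D i (\<lambda>z. - (\<Sum>p\<in>UNIV. \<Gamma> l j p z * H p n z) - (\<Sum>p\<in>UNIV. \<Gamma> n j p z * H p l z)) z"
      by (rule D_cong[OF z]) (auto simp: compatible H_sym[of _ l])
    also have "\<dots> = - (\<Sum>p\<in>UNIV. \<Gamma> l j p z * D i (H p n) z) - (\<Sum>p\<in>UNIV. D i (\<Gamma> l j p) z * H p n z)
        - (\<Sum>p\<in>UNIV. \<Gamma> n j p z * D i (H p l) z) - (\<Sum>p\<in>UNIV. D i (\<Gamma> n j p) z * H p l z)"
      using z by (simp add: D_rules S_intros \<Gamma>_S H_S sum.distrib)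
    finally show ?thesis unfolding sub by simp
  qed
  show ?thesis
    using D_commute[OF H_S z, of i j l n] unfolding DD K using Q[of l n j i] Q[of l n i j] by simp
qed

text \<open>Contract \<open>bianchi\<close> with \<open>H\<close>. As \<open>H\<close> is parallel,
  its derivative cancels the connection term on the contracted index and produces the one on the
  second upper index.\<close>

lemma K_bianchi:
  fixes l n
  assumes z: "z \<in> \<Omega>"
  defines "E \<equiv> \<lambda>m i j. D m (K l n i j) z + (\<Sum>p\<in>UNIV. \<Gamma> l m p z * K p n i j z)
      + (\<Sum>p\<in>UNIV. \<Gamma> n m p z * K l p i j z)"
  shows "E m i j + E i j m + E j m i = 0"
proof -
  define F where "F m i j k = D m (R l i j k) z + (\<Sum>p\<in>UNIV. \<Gamma> l m p z * R p i j k z)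
      - (\<Sum>p\<in>UNIV. R l i j p z * \<Gamma> p m k z)" for m i j k
  have "E m i j = (\<Sum>k\<in>UNIV. F m i j k * H k n z)" for m i j
  proof -
    have "K l n i j = (\<lambda>z. \<Sum>k\<in>UNIV. R l i j k z * H k n z)" by (auto simp: K_def)
    then have "D m (K l n i j) z
        = (\<Sum>k\<in>UNIV. R l i j k z * D m (H k n) z) + (\<Sum>k\<in>UNIV. D m (R l i j k) z * H k n z)"
      using z by (simp add: D_rules S_intros R_S H_S sum.distrib)
    also have "(\<Sum>k\<in>UNIV. R l i j k z * D m (H k n) z)
        = - (\<Sum>k\<in>UNIV. \<Sum>p\<in>UNIV. R l i j k z * \<Gamma> k m p z * H p n z)
          - (\<Sum>k\<in>UNIV. \<Sum>p\<in>UNIV. R l i j k z * \<Gamma> n m p z * H k p z)"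
      unfolding compatible[OF z]
      by (simp add: right_diff_distrib sum_subtractf sum_negf sum_distrib_left mult_ac)
    also have "(\<Sum>k\<in>UNIV. \<Sum>p\<in>UNIV. R l i j k z * \<Gamma> k m p z * H p n z)
        = (\<Sum>k\<in>UNIV. (\<Sum>p\<in>UNIV. R l i j p z * \<Gamma> p m k z) * H k n z)"
      by (subst sum.swap) (simp add: sum_distrib_right)
    also have "(\<Sum>k\<in>UNIV. \<Sum>p\<in>UNIV. R l i j k z * \<Gamma> n m p z * H k p z)
        = (\<Sum>p\<in>UNIV. \<Gamma> n m p z * K l p i j z)"
      unfolding K_def by (subst sum.swap) (simp add: sum_distrib_left mult_ac)
    finally have "D m (K l n i j) z = (\<Sum>k\<in>UNIV. D m (R l i j k) z * H k n z)
        - (\<Sum>k\<in>UNIV. (\<Sum>p\<in>UNIV. R l i j p z * \<Gamma> p m k z) * H k n z)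
        - (\<Sum>p\<in>UNIV. \<Gamma> n m p z * K l p i j z)" by simp
    moreover have "(\<Sum>p\<in>UNIV. \<Gamma> l m p z * K p n i j z)
        = (\<Sum>k\<in>UNIV. (\<Sum>p\<in>UNIV. \<Gamma> l m p z * R p i j k z) * H k n z)"
      unfolding K_def sum_distrib_left sum_distrib_right by (subst sum.swap) (simp add: mult_ac)
    ultimately show ?thesis
      unfolding E_def F_def by (simp add: distrib_right left_diff_distrib sum.distrib sum_subtractf)
  qed
  then have "E m i j + E i j m + E j m i = (\<Sum>k\<in>UNIV. (F m i j k + F i j m k + F j m i k) * H k n z)"
    by (simp add: distrib_right sum.distrib)
  also have "\<dots> = 0" using bianchi[OF z] by (simp add: F_def)
  finally show ?thesis .
qed

text \<open>As a trace of \<open>K\<close>, the raised Ricci tensor becomes accessible to the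
  antisymmetries of \<open>K\<close>.\<close>

lemma ricci_up_eq_K:
  assumes z: "z \<in> \<Omega>"
  shows "ricci_up l i z = (\<Sum>p\<in>UNIV. K p l p i z)"
  unfolding ricci_up_def raise_def ricci_def K_def sum_distrib_left
  by (subst sum.swap) (simp add: H_sym[OF z, of l] mult_ac)

lemma ricci_up_S: "ricci_up l i \<in> S"
proof -
  have "ricci_up l i = (\<lambda>z. \<Sum>k\<in>UNIV. H l k z * ricci D \<Gamma> i k z)" by (auto simp: ricci_up_def raise_def)
  then show ?thesis by (auto intro!: S_intros ricci_S H_S)
qed

lemma D_ricci_up:
  assumes z: "z \<in> \<Omega>"
  shows "D m (ricci_up l i) z = (\<Sum>p\<in>UNIV. D m (K p l p i) z)"
proof -
  have "D m (ricci_up l i) z = D m (\<lambda>z. \<Sum>p\<in>UNIV. K p l p i z) z"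
    by (rule D_cong[OF z]) (rule ricci_up_eq_K)
  then show ?thesis using z by (simp add: D_sum K_S)
qed

lemma D_tr_ricci_up:
  assumes z: "z \<in> \<Omega>"
  shows "D i (\<lambda>y. \<Sum>p\<in>UNIV. ricci_up p p y) z = (\<Sum>p\<in>UNIV. D i (ricci_up p p) z)"
  using z by (simp add: D_sum ricci_up_S)

text \<open>The metric may be degenerate, and \<open>i\<close> may be any direction: with \<open>i = 0\<close> on space-time this
  is the evolution equation of the scalar curvature.\<close>

lemma contracted_bianchi:
  assumes z: "z \<in> \<Omega>"
  shows "2 * ((\<Sum>p\<in>UNIV. D p (ricci_up p i) z) + (\<Sum>p\<in>UNIV. \<Sum>q\<in>UNIV. \<Gamma> p p q z * ricci_up q i z)
      - (\<Sum>p\<in>UNIV. \<Sum>q\<in>UNIV. \<Gamma> q p i z * ricci_up p q z)) = D i (\<lambda>y. \<Sum>p\<in>UNIV. ricci_up p p y) z"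
proof -
  \<comment> \<open>Used to drop the terms in which the symmetric lower indices of \<Gamma> meet the
    skew upper indices of \<open>K\<close>.\<close>
  have sym_antisym: "(\<Sum>p\<in>UNIV. \<Sum>q\<in>UNIV. a p q * b p q) = 0"
    if "\<And>p q. a p q = a q p" "\<And>p q. b q p = - b p q" for a b :: "'k \<Rightarrow> 'k \<Rightarrow> real"
  proof -
    have "(\<Sum>p\<in>UNIV. \<Sum>q\<in>UNIV. a p q * b p q) = (\<Sum>p\<in>UNIV. \<Sum>q\<in>UNIV. a q p * b q p)"
      by (rule sum.swap)
    also have "\<dots> = - (\<Sum>p\<in>UNIV. \<Sum>q\<in>UNIV. a p q * b p q)"
      unfolding sum_negf[symmetric] using that by (intro sum.cong refl) (metis mult_minus_right)
    finally show ?thesis by simp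
  qed
  have Da: "D m (K l n j i) z = - D m (K l n i j) z" for m l n i j
    using D_cong[OF z, of "K l n j i" "\<lambda>y. - K l n i j y" m] D_minus[OF K_S z] K_antisym_form by metis
  have Db: "D m (K n l i j) z = - D m (K l n i j) z" for m l n i j
    using D_cong[OF z, of "K n l i j" "\<lambda>y. - K l n i j y" m] D_minus[OF K_S z] K_antisym by metis
  note anti = K_antisym_form K_antisym[OF z]
  have trK: "(\<Sum>j\<in>UNIV. K l j i j z) = ricci_up l i z" for l i
    unfolding ricci_up_eq_K[OF z] by (intro sum.cong refl) (metis anti minus_minus)
  have trK': "(\<Sum>j\<in>UNIV. K l j j i z) = - ricci_up l i z" for l i
    unfolding ricci_up_eq_K[OF z] sum_negf[symmetric] by (intro sum.cong refl) (rule K_antisym[OF z])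
  have trK'': "(\<Sum>j\<in>UNIV. K j l i j z) = - ricci_up l i z" for l i
    unfolding ricci_up_eq_K[OF z] sum_negf[symmetric] by (intro sum.cong refl) (rule K_antisym_form)
  \<comment> \<open>\<open>K_bianchi\<close> is traced over \<open>m = l\<close> and
    \<open>n = j\<close>, and its nine terms are evaluated one by one. They form two copies of the
    divergence of Ricci and one negative derivative of its trace.\<close>
  have "(\<Sum>l\<in>UNIV. \<Sum>j\<in>UNIV. D l (K l j i j) z) = (\<Sum>p\<in>UNIV. D p (ricci_up p i) z)"
    unfolding D_ricci_up[OF z] by (intro sum.cong refl) (metis Da Db minus_minus)
  moreover have "(\<Sum>l\<in>UNIV. \<Sum>j\<in>UNIV. \<Sum>p\<in>UNIV. \<Gamma> l l p z * K p j i j z)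
      = (\<Sum>p\<in>UNIV. \<Sum>q\<in>UNIV. \<Gamma> p p q z * ricci_up q i z)"
    unfolding trK[symmetric] sum_distrib_left by (intro sum.cong refl sum.swap)
  moreover have "(\<Sum>l\<in>UNIV. \<Sum>j\<in>UNIV. \<Sum>p\<in>UNIV. \<Gamma> j l p z * K l p i j z) = 0"
    by (subst sum.swap) (intro sum.neutral ballI sym_antisym \<Gamma>_sym[OF z] K_antisym[OF z])
  moreover have "(\<Sum>l\<in>UNIV. \<Sum>j\<in>UNIV. D i (K l j j l) z) = - D i (\<lambda>y. \<Sum>p\<in>UNIV. ricci_up p p y) z"
    unfolding D_tr_ricci_up[OF z] D_ricci_up[OF z] sum_negf[symmetric]
    by (intro sum.cong refl) (metis Db)
  moreover have "(\<Sum>l\<in>UNIV. \<Sum>j\<in>UNIV. \<Sum>p\<in>UNIV. \<Gamma> l i p z * K p j j l z)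
      = - (\<Sum>p\<in>UNIV. \<Sum>q\<in>UNIV. \<Gamma> q p i z * ricci_up p q z)"
  proof -
    have "(\<Sum>l\<in>UNIV. \<Sum>j\<in>UNIV. \<Sum>p\<in>UNIV. \<Gamma> l i p z * K p j j l z)
        = (\<Sum>l\<in>UNIV. \<Sum>p\<in>UNIV. \<Gamma> l i p z * (\<Sum>j\<in>UNIV. K p j j l z))"
      unfolding sum_distrib_left by (intro sum.cong refl sum.swap)
    then show ?thesis unfolding trK' by (subst (2) sum.swap) (simp add: sum_negf \<Gamma>_sym[OF z, of _ i])
  qed
  moreover have "(\<Sum>l\<in>UNIV. \<Sum>j\<in>UNIV. \<Sum>p\<in>UNIV. \<Gamma> j i p z * K l p j l z)
      = - (\<Sum>p\<in>UNIV. \<Sum>q\<in>UNIV. \<Gamma> q p i z * ricci_up p q z)"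
  proof -
    have "(\<Sum>l\<in>UNIV. \<Sum>j\<in>UNIV. \<Sum>p\<in>UNIV. \<Gamma> j i p z * K l p j l z)
        = (\<Sum>j\<in>UNIV. \<Sum>p\<in>UNIV. \<Gamma> j i p z * (\<Sum>l\<in>UNIV. K l p j l z))"
      unfolding sum_distrib_left by (subst sum.swap) (intro sum.cong refl sum.swap)
    then show ?thesis unfolding trK'' by (subst (2) sum.swap) (simp add: sum_negf \<Gamma>_sym[OF z, of _ i])
  qed
  moreover have "(\<Sum>l\<in>UNIV. \<Sum>j\<in>UNIV. D j (K l j l i) z) = (\<Sum>p\<in>UNIV. D p (ricci_up p i) z)"
    unfolding D_ricci_up[OF z] by (rule sum.swap)
  moreover have "(\<Sum>l\<in>UNIV. \<Sum>j\<in>UNIV. \<Sum>p\<in>UNIV. \<Gamma> l j p z * K p j l i z) = 0"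
    by (intro sum.neutral ballI sym_antisym \<Gamma>_sym[OF z] K_antisym[OF z])
  moreover have "(\<Sum>l\<in>UNIV. \<Sum>j\<in>UNIV. \<Sum>p\<in>UNIV. \<Gamma> j j p z * K l p l i z)
      = (\<Sum>p\<in>UNIV. \<Sum>q\<in>UNIV. \<Gamma> p p q z * ricci_up q i z)"
    unfolding ricci_up_eq_K[OF z] sum_distrib_left by (subst sum.swap) (intro sum.cong refl sum.swap)
  moreover have "(\<Sum>l\<in>UNIV. \<Sum>j\<in>UNIV.
      (D l (K l j i j) z + (\<Sum>p\<in>UNIV. \<Gamma> l l p z * K p j i j z) + (\<Sum>p\<in>UNIV. \<Gamma> j l p z * K l p i j z))
    + (D i (K l j j l) z + (\<Sum>p\<in>UNIV. \<Gamma> l i p z * K p j j l z) + (\<Sum>p\<in>UNIV. \<Gamma> j i p z * K l p j l z))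
    + (D j (K l j l i) z + (\<Sum>p\<in>UNIV. \<Gamma> l j p z * K p j l i z) + (\<Sum>p\<in>UNIV. \<Gamma> j j p z * K l p l i z))) = 0"
    using K_bianchi[OF z] by (intro sum.neutral ballI) auto
  ultimately show ?thesis by (simp add: sum.distrib)
qed

text \<open>With \<nabla>X = -Ric, \<open>contracted_ricci_identity\<close> reads: gradient of the
  trace minus divergence of Ricci, and the divergence is half the gradient by
  \<open>contracted_bianchi\<close>. The soliton equation is assumed only in direction
  \<open>j\<close>, on the diagonal and where \<Gamma> multiplies it, so that the lemma applies
  before the time direction is settled.\<close>

lemma ricci_soliton_gradient:
  assumes z: "z \<in> \<Omega>" and X: "\<And>k. X k \<in> S"
    and j: "\<And>y k. y \<in> \<Omega> \<Longrightarrow> cov_vector D \<Gamma> X j k y = - ricci_up k j y"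
    and tr: "\<And>y p. y \<in> \<Omega> \<Longrightarrow> cov_vector D \<Gamma> X p p y = - ricci_up p p y"
    and \<Gamma>: "\<And>p q. \<Gamma> q p j z * cov_vector D \<Gamma> X q p z = - (\<Gamma> q p j z * ricci_up p q z)"
  shows "(\<Sum>q\<in>UNIV. ricci D \<Gamma> j q z * X q z) = (1/2) * D j (\<lambda>y. \<Sum>p\<in>UNIV. ricci_up p p y) z"
proof -
  have "D p (cov_vector D \<Gamma> X j p) z = - D p (ricci_up p j) z" for p
    using D_cong[OF z, of "cov_vector D \<Gamma> X j p" "\<lambda>y. - ricci_up p j y"] D_minus[OF ricci_up_S z] j by metis
  moreover have "D j (\<lambda>y. \<Sum>p\<in>UNIV. cov_vector D \<Gamma> X p p y) z = - D j (\<lambda>y. \<Sum>p\<in>UNIV. ricci_up p p y) z"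
  proof -
    have "D j (\<lambda>y. \<Sum>p\<in>UNIV. cov_vector D \<Gamma> X p p y) z = D j (\<lambda>y. - (\<Sum>p\<in>UNIV. ricci_up p p y)) z"
      by (rule D_cong[OF z]) (simp add: tr sum_negf)
    then show ?thesis using z by (simp add: D_minus S_sum ricci_up_S)
  qed
  ultimately show ?thesis
    using contracted_ricci_identity[where X = X and j = j, OF z X] contracted_bianchi[OF z, of j]
    by (simp add: j[OF z] \<Gamma> sum_negf)
qed

section \<open>Covariant differentiation of tensors with raised indices\<close>

lemma raise_S: "(\<And>l. \<omega> l \<in> S) \<Longrightarrow> raise H \<omega> k \<in> S"
proof -
  assume "\<And>l. \<omega> l \<in> S"
  moreover have "raise H \<omega> k = (\<lambda>z. \<Sum>l\<in>UNIV. H k l z * \<omega> l z)" by (auto simp: raise_def)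
  ultimately show ?thesis by (auto intro!: S_intros H_S)
qed

text \<open>Raising commutes with \<nabla> because \<open>H\<close> is parallel, written out in
  partial derivatives.\<close>

lemma D_raise:
  assumes z: "z \<in> \<Omega>" and \<omega>: "\<And>l. \<omega> l \<in> S"
  shows "D i (raise H \<omega> k) z + (\<Sum>p\<in>UNIV. \<Gamma> k i p z * raise H \<omega> p z)
    = (\<Sum>l\<in>UNIV. H k l z * (D i (\<omega> l) z - (\<Sum>p\<in>UNIV. \<Gamma> p i l z * \<omega> p z)))"
proof -
  have "raise H \<omega> k = (\<lambda>z. \<Sum>l\<in>UNIV. H k l z * \<omega> l z)" by (auto simp: raise_def)
  then have "D i (raise H \<omega> k) z = (\<Sum>l\<in>UNIV. H k l z * D i (\<omega> l) z) + (\<Sum>l\<in>UNIV. D i (H k l) z * \<omega> l z)"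
    using z by (simp add: D_rules S_intros H_S \<omega> sum.distrib)
  also have "(\<Sum>l\<in>UNIV. D i (H k l) z * \<omega> l z)
      = - (\<Sum>l\<in>UNIV. \<Sum>p\<in>UNIV. \<Gamma> k i p z * (H p l z * \<omega> l z))
        - (\<Sum>l\<in>UNIV. \<Sum>p\<in>UNIV. H k p z * (\<Gamma> l i p z * \<omega> l z))"
    unfolding compatible[OF z]
    by (simp add: algebra_simps sum.distrib sum_subtractf sum_negf sum_distrib_left)
  also have "(\<Sum>l\<in>UNIV. \<Sum>p\<in>UNIV. \<Gamma> k i p z * (H p l z * \<omega> l z)) = (\<Sum>p\<in>UNIV. \<Gamma> k i p z * raise H \<omega> p z)"
    unfolding raise_def sum_distrib_left by (rule sum.swap)
  also have "(\<Sum>l\<in>UNIV. \<Sum>p\<in>UNIV. H k p z * (\<Gamma> l i p z * \<omega> l z))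
      = (\<Sum>l\<in>UNIV. H k l z * (\<Sum>p\<in>UNIV. \<Gamma> p i l z * \<omega> p z))"
    unfolding sum_distrib_left by (rule sum.swap)
  finally show ?thesis by (simp add: right_diff_distrib sum_subtractf)
qed

lemma cov_vector_raise:
  assumes "z \<in> \<Omega>" and "\<And>l. \<omega> l \<in> S"
  shows "cov_vector D \<Gamma> (raise H \<omega>) i k z = raise H (cov_form D \<Gamma> \<omega> i) k z"
  using D_raise[of z \<omega> i k] assms unfolding cov_vector_def raise_def cov_form_def by simp

lemma cov_mixed_raise:
  assumes z: "z \<in> \<Omega>" and B: "\<And>i j. B i j \<in> S"
    and A: "\<And>y k j. y \<in> \<Omega> \<Longrightarrow> A k j y = raise H (B j) k y"
  shows "cov_mixed D \<Gamma> A i k j z = raise H (\<lambda>l. cov_bilinear D \<Gamma> B i j l) k z"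
proof -
  have "D i (A k j) z = D i (raise H (B j) k) z"
    by (rule D_cong[OF z]) (rule A)
  moreover have "(\<Sum>p\<in>UNIV. \<Gamma> p i j z * raise H (B p) k z)
      = (\<Sum>l\<in>UNIV. H k l z * (\<Sum>p\<in>UNIV. \<Gamma> p i j z * B p l z))"
    unfolding raise_def sum_distrib_left by (subst sum.swap) (simp add: mult_ac)
  ultimately show ?thesis
    using D_raise[OF z, of "B j" i k] B unfolding cov_mixed_def cov_bilinear_def
    by (simp add: A[OF z] raise_def[of H "\<lambda>l z. _ l z"] right_diff_distrib sum_subtractf)
qed

text \<open>Since \<open>H\<close> is parallel, only \<omega> is differentiated. On space-time with
  i = 0 this computes the time derivative of the squared norm of \<open>V\<close>.\<close>

lemma D_norm_sq:
  assumes z: "z \<in> \<Omega>" and \<omega>: "\<And>l. \<omega> l \<in> S"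
  shows "D i (\<lambda>y. \<Sum>p\<in>UNIV. \<Sum>q\<in>UNIV. H p q y * \<omega> p y * \<omega> q y) z
    = 2 * (\<Sum>p\<in>UNIV. raise H \<omega> p z * cov_form D \<Gamma> \<omega> i p z)"
proof -
  have Dr: "D i (raise H \<omega> p) z = raise H (cov_form D \<Gamma> \<omega> i) p z - (\<Sum>q\<in>UNIV. \<Gamma> p i q z * raise H \<omega> q z)" for p
    using D_raise[where \<omega> = \<omega> and i = i and k = p, OF z \<omega>] unfolding raise_def cov_form_def by simp
  have "D i (\<lambda>y. \<Sum>p\<in>UNIV. \<Sum>q\<in>UNIV. H p q y * \<omega> p y * \<omega> q y) z
      = D i (\<lambda>y. \<Sum>p\<in>UNIV. raise H \<omega> p y * \<omega> p y) z"
    by (rule D_cong[OF z]) (simp add: raise_def sum_distrib_left sum_distrib_right mult_ac)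
  also have "\<dots> = (\<Sum>p\<in>UNIV. raise H \<omega> p z * D i (\<omega> p) z) + (\<Sum>p\<in>UNIV. D i (raise H \<omega> p) z * \<omega> p z)"
    using z by (simp add: D_rules S_intros raise_S \<omega> sum.distrib)
  also have "(\<Sum>p\<in>UNIV. D i (raise H \<omega> p) z * \<omega> p z)
      = (\<Sum>p\<in>UNIV. raise H (cov_form D \<Gamma> \<omega> i) p z * \<omega> p z)
        - (\<Sum>p\<in>UNIV. raise H \<omega> p z * (\<Sum>q\<in>UNIV. \<Gamma> q i p z * \<omega> q z))"
    unfolding Dr left_diff_distrib sum_subtractf sum_distrib_left sum_distrib_right
    by (subst (2) sum.swap) (simp add: mult_ac)
  also have "(\<Sum>p\<in>UNIV. raise H (cov_form D \<Gamma> \<omega> i) p z * \<omega> p z) = (\<Sum>p\<in>UNIV. raise H \<omega> p z * cov_form D \<Gamma> \<omega> i p z)"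
    unfolding raise_def sum_distrib_right by (subst sum.swap) (simp add: H_sym[OF z] mult_ac)
  finally show ?thesis
    by (simp add: cov_form_def right_diff_distrib sum_subtractf)
qed

end

section \<open>The space-time connection of the modified Ricci flow\<close>

lemma sum_option: "(\<Sum>k\<in>UNIV. f k) = f None + (\<Sum>k\<in>UNIV. f (Some k))"
  for f :: "'n::finite option \<Rightarrow> 'a::comm_monoid_add"
  by (simp add: UNIV_option_conv sum.reindex)

lemma sum_mult_delta:
  fixes f :: "'n::finite \<Rightarrow> 'a::semiring_1"
  shows "(\<Sum>k\<in>UNIV. f k * (if j = k then 1 else 0)) = f j"
    and "(\<Sum>k\<in>UNIV. f k * (if k = j then 1 else 0)) = f j"
  by (simp_all add: if_distrib[of "\<lambda>x. _ * x"] cong: if_cong)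

lemma invertible_if_positive_definite:
  fixes a :: "'n::finite \<Rightarrow> 'n \<Rightarrow> real"
  assumes "\<And>v::real ^ 'n. v \<noteq> 0 \<Longrightarrow> (\<Sum>i\<in>UNIV. \<Sum>j\<in>UNIV. a i j * v $ i * v $ j) > 0"
  shows "invertible (\<chi> i j. a i j)"
proof -
  let ?A = "\<chi> i j. a i j"
  have "v = 0" if "?A *v v = 0" for v
  proof (rule ccontr)
    assume "v \<noteq> 0"
    then have "(\<Sum>i\<in>UNIV. \<Sum>j\<in>UNIV. a i j * v $ i * v $ j) > 0" by (rule assms)
    moreover have "(\<Sum>i\<in>UNIV. \<Sum>j\<in>UNIV. a i j * v $ i * v $ j) = (\<Sum>i\<in>UNIV. v $ i * (?A *v v) $ i)"
      by (simp add: matrix_vector_mult_def sum_distrib_left mult_ac)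
    ultimately show False using that by simp
  qed
  then show ?thesis
    by (simp add: invertible_left_inverse matrix_left_invertible_ker)
qed

section \<open>The chart calculus and the flow in one chart\<close>

context st_domain
begin

sublocale st: derivations \<Omega> S "pd T"
proof unfold_locales
  show "(\<lambda>z. c) \<in> S" for c by (simp add: S_def smooth_on_const)
  show "(\<lambda>z. f z + h z) \<in> S" if "f \<in> S" "h \<in> S" for f h
    using that by (simp add: S_def smooth_on_add)
  show "(\<lambda>z. f z * h z) \<in> S" if "f \<in> S" "h \<in> S" for f h
    using that by (simp add: S_def smooth_on_mult)
qed (fact pd_smooth pd_cong pd_const pd_add pd_mult pd_commute)+

text \<open>The geometry of g(t) is done on the same functions of (x,t), with t as a
  parameter.\<close>

sublocale sp: derivations \<Omega> S spatial_pd
proof -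
  have eq: "spatial_pd = (\<lambda>i. pd T (Some i))" by (intro ext) simp
  show "derivations \<Omega> S spatial_pd"
    unfolding eq
    by unfold_locales (fact st.S_const st.S_add st.S_mult st.S_D st.D_cong st.D_const st.D_add
        st.D_mult st.D_commute)+
qed

end

text \<open>One chart of the theorem. \<open>W\<close> stands for V + \<eta> dt; its time component
  is an arbitrary smooth function and takes the place of \<eta>.\<close>

locale modified_flow = st_domain U T for U :: "(real ^ 'n::finite) set" and T +
  fixes g :: "'n \<Rightarrow> 'n \<Rightarrow> 'n field" and V :: "'n \<Rightarrow> 'n field" and W :: "'n option \<Rightarrow> 'n field"
  assumes g_S: "g i j \<in> S" and W_S: "W k \<in> S" and W_Some: "W (Some i) = V i"
    and g_sym: "z \<in> \<Omega> \<Longrightarrow> g i j z = g j i z"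
    and g_pos: "z \<in> \<Omega> \<Longrightarrow> (v :: real ^ 'n) \<noteq> 0 \<Longrightarrow> (\<Sum>i\<in>UNIV. \<Sum>j\<in>UNIV. g i j z * v $ i * v $ j) > 0"
    and flow: "z \<in> \<Omega> \<Longrightarrow> pd T None (g i j) z = - 2 * Ric g i j z
          + cov_form spatial_pd (christoffel g) V i j z
          + cov_form spatial_pd (christoffel g) V j i z"
begin

abbreviation "D \<equiv> pd T"
abbreviation "u \<equiv> metric_inv g"

lemma V_S: "V i \<in> S"
  using W_S[of "Some i"] W_Some by simp

lemma g_invertible: "z \<in> \<Omega> \<Longrightarrow> invertible (\<chi> i j. g i j z)"
  by (rule invertible_if_positive_definite) (rule g_pos)

lemma u_S: "u i j \<in> S"
  using smooth_on_matrix_inv[of \<Omega> g i j] g_S g_invertible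
  by (simp add: S_def metric_inv_def[abs_def])

lemma u_g:
  assumes z: "z \<in> \<Omega>"
  shows "(\<Sum>k\<in>UNIV. u i k z * g k j z) = (if i = j then 1 else 0)"
    and "(\<Sum>k\<in>UNIV. g i k z * u k j z) = (if i = j then 1 else 0)"
proof -
  let ?g = "\<chi> i j. g i j z"
  have "matrix_inv ?g ** ?g = mat 1" "?g ** matrix_inv ?g = mat 1"
    using invertible_matrix_inv g_invertible[OF z] by blast+
  then have "(matrix_inv ?g ** ?g) $ i $ j = (if i = j then 1 else 0)"
      "(?g ** matrix_inv ?g) $ i $ j = (if i = j then 1 else 0)"
    by (simp_all add: mat_def)
  then show "(\<Sum>k\<in>UNIV. u i k z * g k j z) = (if i = j then 1 else 0)"
      "(\<Sum>k\<in>UNIV. g i k z * u k j z) = (if i = j then 1 else 0)"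
    by (simp_all add: matrix_matrix_mult_def metric_inv_def)
qed

lemma u_sym:
  assumes z: "z \<in> \<Omega>"
  shows "u i j z = u j i z"
proof -
  have "u i j z = (\<Sum>k\<in>UNIV. u i k z * (if j = k then 1 else 0))"
    by (simp only: sum_mult_delta)
  also have "\<dots> = (\<Sum>k\<in>UNIV. \<Sum>l\<in>UNIV. u i k z * (u j l z * g l k z))"
    by (simp add: u_g(1)[OF z, symmetric] sum_distrib_left)
  also have "\<dots> = (\<Sum>l\<in>UNIV. u j l z * (\<Sum>k\<in>UNIV. u i k z * g k l z))"
    by (subst sum.swap) (simp add: sum_distrib_left g_sym[OF z] mult_ac)
  also have "\<dots> = u j i z" by (simp only: u_g(1)[OF z] sum_mult_delta)
  finally show ?thesis .
qed

text \<open>Differentiate \<open>u g = 1\<close> and multiply by \<open>u\<close>; \<open>i\<close>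
  may be the time direction.\<close>

lemma D_u:
  assumes z: "z \<in> \<Omega>"
  shows "D i (u j k) z = - (\<Sum>l\<in>UNIV. \<Sum>p\<in>UNIV. u j l z * u k p z * D i (g l p) z)"
proof -
  have 0: "(\<Sum>l\<in>UNIV. D i (u j l) z * g l p z) = - (\<Sum>l\<in>UNIV. u j l z * D i (g l p) z)" for p
  proof -
    have "D i (\<lambda>y. \<Sum>l\<in>UNIV. u j l y * g l p y) z = D i (\<lambda>y. if j = p then 1 else 0) z"
      by (rule st.D_cong[OF z]) (rule u_g)
    also have "\<dots> = 0" by (rule st.D_const[OF z])
    finally show ?thesis using z by (simp add: st.D_rules st.S_intros u_S g_S sum.distrib)
  qed
  have "D i (u j k) z = (\<Sum>l\<in>UNIV. D i (u j l) z * (\<Sum>p\<in>UNIV. g l p z * u p k z))"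
    by (simp only: u_g[OF z] sum_mult_delta)
  also have "\<dots> = (\<Sum>p\<in>UNIV. (\<Sum>l\<in>UNIV. D i (u j l) z * g l p z) * u p k z)"
    unfolding sum_distrib_left sum_distrib_right by (subst sum.swap) (simp add: mult_ac)
  also have "\<dots> = - (\<Sum>p\<in>UNIV. \<Sum>l\<in>UNIV. u j l z * u k p z * D i (g l p) z)"
    unfolding 0 by (simp add: sum_negf sum_distrib_left u_sym[OF z, of k] mult_ac)
  also have "\<dots> = - (\<Sum>l\<in>UNIV. \<Sum>p\<in>UNIV. u j l z * u k p z * D i (g l p) z)"
    by (subst sum.swap) simp
  finally show ?thesis .
qed

section \<open>The space-time connection as Christoffel symbols of \<open>G\<close>\<close>

definition F :: "'n field" where "F = (\<lambda>z. scal g z + norm_sq g V z)"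

fun G :: "'n option \<Rightarrow> 'n option \<Rightarrow> 'n field" where
  "G (Some i) (Some j) = g i j"
| "G (Some i) None = V i"
| "G None (Some i) = V i"
| "G None None = F"

text \<open>Christoffel symbols of the first kind of \<open>G\<close>. The index \<open>l\<close> is
  spatial only, since raising with the degenerate metric sees no other.\<close>

definition L :: "'n \<Rightarrow> 'n option \<Rightarrow> 'n option \<Rightarrow> 'n field" where
  "L l i j z = (1/2) * (D i (G j (Some l)) z + D j (G i (Some l)) z - D (Some l) (G i j) z)"

lemma G_sym: "z \<in> \<Omega> \<Longrightarrow> G i j z = G j i z"
  by (cases i; cases j) (auto simp: g_sym)

lemma D_G_sym: "z \<in> \<Omega> \<Longrightarrow> D k (G i j) z = D k (G j i) z"
  by (rule st.D_cong) (auto intro: G_sym)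

lemma L_sym: "z \<in> \<Omega> \<Longrightarrow> L l i j z = L l j i z"
  using D_G_sym[of z "Some l" i j] by (simp add: L_def)

lemma L_metric: "z \<in> \<Omega> \<Longrightarrow> L l i (Some p) z + L p i (Some l) z = D i (g l p) z"
  using D_G_sym[of z i "Some l" "Some p"] D_G_sym[of z "Some l" i "Some p"] D_G_sym[of z "Some p" i "Some l"]
  by (simp add: L_def field_simps)

lemma christoffel_eq_L: "christoffel g k i j z = (\<Sum>l\<in>UNIV. u k l z * L l (Some i) (Some j) z)"
  by (simp add: christoffel_def L_def sum_distrib_left mult_ac)

text \<open>The coefficients \<open>C\<close> are left abstract to serve both
  \<open>christoffel g\<close> and the space-time connection in any direction \<open>i\<close>.
  Compatibility is \<open>L_metric\<close> inserted into the derivative of the inverse.\<close>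

lemma u_compatible:
  assumes z: "z \<in> \<Omega>" and C: "\<And>j p. C j p = (\<Sum>l\<in>UNIV. u j l z * L l i (Some p) z)"
  shows "D i (u j k) z = - (\<Sum>p\<in>UNIV. C j p * u p k z) - (\<Sum>p\<in>UNIV. C k p * u j p z)"
proof -
  have 1: "(\<Sum>p\<in>UNIV. C j p * u p k z) = (\<Sum>l\<in>UNIV. \<Sum>p\<in>UNIV. u j l z * u k p z * L l i (Some p) z)" for j k
    unfolding C sum_distrib_right by (subst sum.swap) (simp add: u_sym[OF z, of k] mult_ac)
  have 2: "(\<Sum>p\<in>UNIV. C k p * u j p z) = (\<Sum>l\<in>UNIV. \<Sum>p\<in>UNIV. u j l z * u k p z * L p i (Some l) z)"
    unfolding C sum_distrib_right by (simp add: mult_ac)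
  show ?thesis unfolding D_u[OF z] 1 2 L_metric[OF z, symmetric]
    by (simp add: distrib_left sum.distrib)
qed

end

sublocale modified_flow \<subseteq> sp: compatible_connection \<Omega> S spatial_pd "christoffel g" "metric_inv g"
proof unfold_locales
  fix i j k l z
  show "christoffel g l i k \<in> S"
  proof -
    have "christoffel g l i k = (\<lambda>z. (1/2) * (\<Sum>m\<in>UNIV. u l m z *
        (spatial_pd i (g k m) z + spatial_pd k (g i m) z - spatial_pd m (g i k) z)))"
      by (auto simp: christoffel_def)
    moreover have "\<dots> \<in> S" by (intro sp.S_intros u_S g_S)
    ultimately show ?thesis by simp
  qed
  show "christoffel g l i k z = christoffel g l k i z" if "z \<in> \<Omega>"
    using L_sym[OF that] by (simp add: christoffel_eq_L)
  show "u i j \<in> S" by (rule u_S)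
  show "u i j z = u j i z" if "z \<in> \<Omega>" using u_sym[OF that] .
  show "spatial_pd i (u j k) z = - (\<Sum>p\<in>UNIV. christoffel g j i p z * u p k z)
      - (\<Sum>p\<in>UNIV. christoffel g k i p z * u j p z)" if "z \<in> \<Omega>"
    using u_compatible[OF that, of "\<lambda>j p. christoffel g j i p z" "Some i" j k] christoffel_eq_L by simp
qed

context modified_flow
begin

abbreviation "\<Gamma>t \<equiv> st_conn T g V"
abbreviation "H \<equiv> st_metric g"

lemma Ric_S: "Ric g i j \<in> S"
  unfolding Ric_def by (rule sp.ricci_S)

lemma F_S: "F \<in> S"
  unfolding F_def scal_def norm_sq_def by (intro st.S_intros u_S Ric_S V_S)

lemma G_S: "G i j \<in> S"
  by (cases i; cases j) (auto simp: g_S V_S F_S)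

lemma L_S: "L l i j \<in> S"
proof -
  have "L l i j = (\<lambda>z. (1/2) * (D i (G j (Some l)) z + D j (G i (Some l)) z - D (Some l) (G i j) z))"
    by (auto simp: L_def)
  moreover have "\<dots> \<in> S" by (intro st.S_intros G_S)
  ultimately show ?thesis by simp
qed

text \<open>Here the flow enters: in \<open>L l (Some i) None\<close> the symmetric part of
  \<nabla>V comes from the time derivative of g, the skew part from the derivatives of
  \<open>V\<close>, and together they give -Ric + \<nabla>V.\<close>

lemma st_mixed_coeff_eq:
  assumes z: "z \<in> \<Omega>"
  shows "st_mixed_coeff g V k i z = (\<Sum>l\<in>UNIV. u k l z * L l (Some i) None z)"
proof -
  let ?cov = "cov_form spatial_pd (christoffel g) V"
  have "(\<Sum>p\<in>UNIV. christoffel g p i l z * V p z) = (\<Sum>p\<in>UNIV. christoffel g p l i z * V p z)" for l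
    using sp.\<Gamma>_sym[OF z, of _ i l] by simp
  then have "- Ric g i l z + ?cov i l z = L l (Some i) None z" for l
    using flow[OF z, of i l] by (simp add: L_def cov_form_def)
  then have "(\<Sum>l\<in>UNIV. u k l z * L l (Some i) None z)
      = (\<Sum>l\<in>UNIV. u k l z * (- Ric g i l z + ?cov i l z))" by simp
  also have "\<dots> = st_mixed_coeff g V k i z"
    unfolding st_mixed_coeff_def sp.cov_vector_raise[where \<omega> = V, OF z V_S] raise_def
    by (simp add: right_diff_distrib sum_subtractf)
  finally show ?thesis ..
qed

text \<open>The entries \<open>V\<close> and \<open>F\<close> of \<open>G\<close> are chosen for
  this: half the gradient of \<open>F\<close> and the time derivative of \<open>V\<close> are the
  defining terms of the component with two time indices.\<close>

lemma st_conn_eq: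
  assumes z: "z \<in> \<Omega>"
  shows "\<Gamma>t (Some k) i j z = (\<Sum>l\<in>UNIV. u k l z * L l i j z)"
proof (cases i; cases j)
  assume "i = None" "j = None"
  moreover have "- (1/2) * raise u (\<lambda>p. spatial_pd p F) k z + (\<Sum>p\<in>UNIV. u k p z * D None (V p) z)
     = (\<Sum>l\<in>UNIV. u k l z * (D None (V l) z - (1/2) * spatial_pd l F z))"
    by (simp add: raise_def right_diff_distrib sum_subtractf sum_negf sum_distrib_left mult_ac)
  ultimately show ?thesis by (simp add: L_def F_def diff_divide_distrib)
next
  fix b assume "i = None" "j = Some b"
  then show ?thesis using st_mixed_coeff_eq[OF z] L_sym[OF z] by simp
next
  fix a assume "i = Some a" "j = None"
  then show ?thesis using st_mixed_coeff_eq[OF z] by simp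
next
  fix a b assume "i = Some a" "j = Some b"
  then show ?thesis using christoffel_eq_L by simp
qed

lemma H_None [simp]: "H None j = (\<lambda>z. 0)" "H i None = (\<lambda>z. 0)"
  by (cases j; simp) (cases i; simp)

end

text \<open>Components with an upper time index vanish for both the connection and the metric, so
  parallelism reduces to the spatial block, where it is \<open>u_compatible\<close>.\<close>

sublocale modified_flow \<subseteq> st: compatible_connection \<Omega> S "pd T" "st_conn T g V" "st_metric g"
proof unfold_locales
  fix i j k l z
  show "\<Gamma>t l i k \<in> S"
  proof (cases l)
    case None
    then show ?thesis by (simp add: st.S_const)
  next
    case (Some m)
    have "smooth_on \<Omega> (\<lambda>z. \<Sum>l\<in>UNIV. u m l z * L l i k z)"
      using st.S_sum[of UNIV "\<lambda>l z. u m l z * L l i k z"] st.S_mult[OF u_S L_S] by (simp add: S_def)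
    then have "smooth_on \<Omega> (\<Gamma>t (Some m) i k)"
      by (rule smooth_on_cong[rotated]) (simp add: st_conn_eq)
    then show ?thesis using Some by (simp add: S_def)
  qed
  show "\<Gamma>t l i k z = \<Gamma>t l k i z" if "z \<in> \<Omega>"
    using L_sym[OF that] st_conn_eq[OF that] by (cases l) auto
  show "H i j \<in> S"
    by (cases i; cases j) (auto simp: u_S st.S_const)
  show "H i j z = H j i z" if "z \<in> \<Omega>"
    using u_sym[OF that] by (cases i; cases j) auto
  show "D i (H j k) z = - (\<Sum>p\<in>UNIV. \<Gamma>t j i p z * H p k z) - (\<Sum>p\<in>UNIV. \<Gamma>t k i p z * H j p z)"
    if "z \<in> \<Omega>"
    using u_compatible[OF that, of "\<lambda>j p. \<Gamma>t (Some j) i (Some p) z" i] st_conn_eq[OF that] st.D_const[OF that]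
    by (cases j; cases k) (simp_all add: sum_option)
qed

section \<open>The Ricci tensor of space-time\<close>

context modified_flow
begin

abbreviation "Rt \<equiv> st_Ric T g V"

lemma raise_H: "raise H \<omega> None z = 0" "raise H \<omega> (Some k) z = (\<Sum>l\<in>UNIV. u k l z * \<omega> (Some l) z)"
  by (simp_all add: raise_def sum_option)

lemma Rt_S: "Rt i j \<in> S"
  unfolding st_Ric_def by (rule st.ricci_S)

text \<open>Every summand in which the time index is summed contains a connection coefficient with
  upper time index, hence vanishes.\<close>

lemma Rt_spatial:
  assumes z: "z \<in> \<Omega>"
  shows "Rt (Some i) (Some j) z = Ric g i j z"
  using z unfolding st_Ric_def Ric_def ricci_def curvature_def
  by (simp add: sum_option st.D_const sp.D_const del: pd.simps(1))

text \<open>The traced connection is the differential of log sqrt det g, a closed form, so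
  \<open>ricci_skew\<close> gives symmetry. Closedness is verified on \<tau> directly.\<close>

lemma Rt_sym:
  assumes z: "z \<in> \<Omega>"
  shows "Rt j k z = Rt k j z"
proof -
  define \<tau> where "\<tau> k y = (\<Sum>p\<in>UNIV. \<Sum>l\<in>UNIV. (1/2) * (u p l y * D k (g p l) y))" for k y
  have \<tau>: "(\<Sum>p\<in>UNIV. \<Gamma>t p p k y) = \<tau> k y" if y: "y \<in> \<Omega>" for k y
  proof -
    have "(\<Sum>p\<in>UNIV. \<Gamma>t p p k y) = (\<Sum>p\<in>UNIV. \<Sum>l\<in>UNIV. u p l y * L l (Some p) k y)"
      by (simp add: sum_option st_conn_eq[OF y])
    moreover have "(\<Sum>p\<in>UNIV. \<Sum>l\<in>UNIV. u p l y * L l (Some p) k y)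
        = (\<Sum>p\<in>UNIV. \<Sum>l\<in>UNIV. u p l y * L p (Some l) k y)"
      by (subst sum.swap) (simp add: u_sym[OF y])
    moreover have "L l (Some p) k y + L p (Some l) k y = D k (g p l) y" for p l
      using L_metric[OF y, of l k p] L_sym[OF y] D_G_sym[OF y, of k "Some l" "Some p"] by simp
    then have "(\<Sum>p\<in>UNIV. \<Sum>l\<in>UNIV. u p l y * L l (Some p) k y)
        + (\<Sum>p\<in>UNIV. \<Sum>l\<in>UNIV. u p l y * L p (Some l) k y)
        = (\<Sum>p\<in>UNIV. \<Sum>l\<in>UNIV. u p l y * D k (g p l) y)"
      by (simp add: sum.distrib[symmetric] distrib_left[symmetric])
    ultimately show ?thesis by (simp add: \<tau>_def sum_divide_distrib[symmetric])
  qed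
  have "D j (\<tau> k) z = D k (\<tau> j) z" for j k
  proof -
    have D\<tau>: "D j (\<tau> k) z = (\<Sum>p\<in>UNIV. \<Sum>l\<in>UNIV. (1/2) * (u p l z * D j (D k (g p l)) z))
        + (1/2) * (\<Sum>p\<in>UNIV. \<Sum>l\<in>UNIV. D j (u p l) z * D k (g p l) z)" for j k
    proof -
      have "\<tau> k = (\<lambda>y. \<Sum>p\<in>UNIV. \<Sum>l\<in>UNIV. (1/2) * (u p l y * D k (g p l) y))"
        by (auto simp: \<tau>_def)
      then show ?thesis using z
        by (simp only: st.D_rules st.S_intros u_S g_S)
          (simp add: distrib_left sum.distrib sum_distrib_left add_divide_distrib)
    qed
    \<comment> \<open>What differentiating \<open>u\<close> in \<tau> produces, up to sign. Renaming
      (p,l) and (a,b) into each other exchanges \<open>j\<close> and \<open>k\<close>.\<close>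
    define Q where "Q j k = (\<Sum>(p, l)\<in>UNIV. \<Sum>(a, b)\<in>UNIV.
        u p a z * u l b z * D j (g a b) z * D k (g p l) z)" for j k
    have "(\<Sum>p\<in>UNIV. \<Sum>l\<in>UNIV. D j (u p l) z * D k (g p l) z) = - Q j k" for j k
      by (simp add: Q_def UNIV_Times_UNIV[symmetric] sum.cartesian_product[symmetric] D_u[OF z]
          sum_negf sum_distrib_right del: UNIV_Times_UNIV)
    moreover have "Q j k = Q k j"
      unfolding Q_def split_def by (subst sum.swap) (simp add: u_sym[OF z] mult_ac)
    ultimately have "(\<Sum>p\<in>UNIV. \<Sum>l\<in>UNIV. D j (u p l) z * D k (g p l) z)
        = (\<Sum>p\<in>UNIV. \<Sum>l\<in>UNIV. D k (u p l) z * D j (g p l) z)" by simp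
    then show ?thesis unfolding D\<tau> st.D_commute[OF g_S z, of j k] by simp
  qed
  moreover have "D j (\<lambda>y. \<Sum>p\<in>UNIV. \<Gamma>t p p k y) z = D j (\<tau> k) z" for j k
    by (rule st.D_cong[OF z]) (rule \<tau>)
  ultimately have "ricci D \<Gamma>t j k z - ricci D \<Gamma>t k j z = 0"
    using st.ricci_skew[OF z, of j k] by simp
  then show ?thesis by (simp add: st_Ric_def)
qed

section \<open>The soliton vector field and the time components of Ricci\<close>

definition X :: "'n option \<Rightarrow> 'n field" where
  "X k = (case k of None \<Rightarrow> (\<lambda>z. 1) | Some i \<Rightarrow> (\<lambda>z. - raise u V i z))"

lemma X_S: "X k \<in> S"
  using sp.raise_S[of V] V_S by (cases k) (auto simp: X_def intro: st.S_const st.S_minus)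

lemma raise_H_W: "raise H W None = (\<lambda>z. 0)" "raise H W (Some k) = raise u V k"
  unfolding fun_eq_iff raise_H W_Some by (simp_all add: raise_def)

lemma cov_X_None: "z \<in> \<Omega> \<Longrightarrow> cov_vector D \<Gamma>t X i None z = 0"
  by (simp add: cov_vector_def X_def st.D_const)

text \<open>\<open>X\<close> is \<partial>_t minus the raised \<open>W\<close>, and the covariant
  derivative of the coordinate field \<partial>_t is the connection coefficient with lower time
  index.\<close>

lemma cov_X_Some:
  assumes z: "z \<in> \<Omega>"
  shows "cov_vector D \<Gamma>t X i (Some k) z
    = \<Gamma>t (Some k) i None z - cov_vector D \<Gamma>t (raise H W) i (Some k) z"
  using st.D_minus[OF sp.raise_S[of V k, OF V_S] z, of i]
  by (simp add: cov_vector_def X_def sum_option raise_H_W sum_negf)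

lemma ricci_up_None: "st.ricci_up None i z = 0"
  by (simp add: st.ricci_up_def raise_H)

lemma ricci_up_Some: "st.ricci_up (Some k) i z = (\<Sum>l\<in>UNIV. u k l z * Rt i (Some l) z)"
  by (simp add: st.ricci_up_def raise_H st_Ric_def)

lemma tr_ricci_up: "z \<in> \<Omega> \<Longrightarrow> (\<Sum>p\<in>UNIV. st.ricci_up p p z) = scal g z"
  by (simp add: sum_option ricci_up_None ricci_up_Some Rt_spatial scal_def)

lemma scal_S: "scal g \<in> S"
  unfolding scal_def[abs_def] by (intro st.S_intros u_S Ric_S)

lemma D_tr_ricci_up: "z \<in> \<Omega> \<Longrightarrow> D i (\<lambda>y. \<Sum>p\<in>UNIV. st.ricci_up p p y) z = D i (scal g) z"
  by (rule st.D_cong) (auto intro: tr_ricci_up)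

text \<open>In spatial directions the soliton equation is the definition of
  \<open>st_mixed_coeff\<close>: its \<nabla>V part cancels and -Ric remains.\<close>

lemma cov_X_spatial:
  assumes z: "z \<in> \<Omega>"
  shows "cov_vector D \<Gamma>t X (Some i) k z = - st.ricci_up k (Some i) z"
proof (cases k)
  case None
  then show ?thesis using cov_X_None[OF z] by (simp add: ricci_up_None)
next
  case (Some l)
  have "cov_vector D \<Gamma>t (raise H W) (Some i) (Some l) z
      = cov_vector spatial_pd (christoffel g) (raise u V) i l z"
    by (simp add: cov_vector_def raise_H_W sum_option)
  moreover have "st.ricci_up (Some l) (Some i) z = raise u (Ric g i) l z"
    using z by (simp add: ricci_up_Some Rt_spatial raise_def)
  ultimately show ?thesis
    using cov_X_Some[OF z] Some by (simp add: st_mixed_coeff_def)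
qed

lemma cov_X_trace: "z \<in> \<Omega> \<Longrightarrow> cov_vector D \<Gamma>t X p p z = - st.ricci_up p p z"
  using cov_X_None cov_X_spatial by (cases p) (auto simp: ricci_up_None)

lemma cov_X_\<Gamma>:
  assumes z: "z \<in> \<Omega>"
  shows "\<Gamma>t q p j z * cov_vector D \<Gamma>t X q p z = - (\<Gamma>t q p j z * st.ricci_up p q z)"
  using cov_X_spatial[OF z] by (cases q) auto

text \<open>Solves the gradient identity for the time component, using that the time component of
  \<open>X\<close> is 1. It serves spatial \<open>j\<close> first, and j = 0 once
  \<open>cov_X_time\<close> is known.\<close>

lemma Rt_X:
  assumes z: "z \<in> \<Omega>" and j: "\<And>y k. y \<in> \<Omega> \<Longrightarrow> cov_vector D \<Gamma>t X j k y = - st.ricci_up k j y"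
  shows "Rt j None z = (1/2) * D j (scal g) z + (\<Sum>q\<in>UNIV. Rt j (Some q) z * raise u V q z)"
proof -
  have "(\<Sum>q\<in>UNIV. ricci D \<Gamma>t j q z * X q z) = (1/2) * D j (\<lambda>y. \<Sum>p\<in>UNIV. st.ricci_up p p y) z"
    by (rule st.ricci_soliton_gradient[OF z X_S j cov_X_trace cov_X_\<Gamma>[OF z]])
  then show ?thesis
    unfolding D_tr_ricci_up[OF z] st_Ric_def[symmetric] sum_option[of "\<lambda>q. _ q * X q z"]
    by (simp add: X_def sum_negf del: pd.simps)
qed

text \<open>Half the gradient of \<open>F\<close> contains, besides that of the scalar curvature,
  the pairing of \<nabla>V with \<open>V\<close>; subtracting \<open>st_mixed_coeff\<close> paired
  with \<open>V\<close> removes it and leaves the Ricci term of \<open>Rt_X\<close>.\<close>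

lemma Rt_spatial_time:
  assumes z: "z \<in> \<Omega>"
  shows "Rt (Some j) None z
    = (1/2) * D (Some j) F z - (\<Sum>p\<in>UNIV. st_mixed_coeff g V p j z * V p z)"
proof -
  have "D (Some j) F z = D (Some j) (scal g) z + spatial_pd j (norm_sq g V) z"
  proof -
    have "norm_sq g V \<in> S"
      unfolding norm_sq_def[abs_def] by (intro st.S_intros u_S V_S)
    then show ?thesis using st.D_add[OF scal_S _ z, of "norm_sq g V" "Some j"] by (simp add: F_def)
  qed
  moreover have "spatial_pd j (norm_sq g V) z
      = 2 * (\<Sum>p\<in>UNIV. cov_vector spatial_pd (christoffel g) (raise u V) j p z * V p z)"
  proof -
    have "(\<Sum>p\<in>UNIV. raise u V p z * cov_form spatial_pd (christoffel g) V j p z)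
        = (\<Sum>p\<in>UNIV. raise u (cov_form spatial_pd (christoffel g) V j) p z * V p z)"
      unfolding raise_def sum_distrib_right by (subst sum.swap) (simp add: u_sym[OF z] mult_ac)
    then show ?thesis
      using sp.D_norm_sq[where \<omega> = V and i = j, OF z V_S]
        sp.cov_vector_raise[where \<omega> = V and i = j, OF z V_S]
      by (simp add: norm_sq_def[abs_def])
  qed
  moreover have "(\<Sum>p\<in>UNIV. raise u (Ric g j) p z * V p z) = (\<Sum>q\<in>UNIV. Rt (Some j) (Some q) z * raise u V q z)"
    unfolding raise_def sum_distrib_left sum_distrib_right
    by (subst sum.swap) (simp add: Rt_spatial[OF z] u_sym[OF z] mult_ac)
  ultimately show ?thesis
    using Rt_X[OF z cov_X_spatial, of j]
    by (simp add: st_mixed_coeff_def distrib_right left_diff_distrib sum.distrib sum_negf sum_subtractf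
        add_divide_distrib)
qed

lemma cov_W_time:
  "cov_form D \<Gamma>t W None (Some l) z = D None (V l) z - (\<Sum>p\<in>UNIV. st_mixed_coeff g V p l z * V p z)"
  "cov_form D \<Gamma>t W (Some l) None z = D (Some l) (W None) z - (\<Sum>p\<in>UNIV. st_mixed_coeff g V p l z * V p z)"
  by (simp_all add: cov_form_def sum_option W_Some)

lemma st_conn_time_time:
  assumes z: "z \<in> \<Omega>"
  shows "\<Gamma>t (Some k) None None z
    = (\<Sum>l\<in>UNIV. u k l z * (D None (V l) z - (1/2) * D (Some l) F z))"
  unfolding st_conn_eq[OF z] L_def by (intro sum.cong refl) (simp add: diff_divide_distrib)

text \<open>The time derivatives of \<open>V\<close> cancel between the connection coefficient and
  the derivative of the raised \<open>W\<close>. The remainder is minus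
  \<open>Rt_spatial_time\<close>, read with exchanged indices by symmetry of Ricci.\<close>

lemma cov_X_time:
  assumes z: "z \<in> \<Omega>"
  shows "cov_vector D \<Gamma>t X None k z = - st.ricci_up k None z"
proof (cases k)
  case None
  then show ?thesis using cov_X_None[OF z] by (simp add: ricci_up_None)
next
  case (Some l)
  have "cov_vector D \<Gamma>t (raise H W) None (Some l) z
     = (\<Sum>m\<in>UNIV. u l m z * (D None (V m) z - (\<Sum>p\<in>UNIV. st_mixed_coeff g V p m z * V p z)))"
    by (simp only: st.cov_vector_raise[where \<omega> = W, OF z W_S] raise_H cov_W_time)
  then have "cov_vector D \<Gamma>t X None (Some l) z
     = (\<Sum>m\<in>UNIV. u l m z * (D None (V m) z - (1/2) * D (Some m) F z))
       - (\<Sum>m\<in>UNIV. u l m z * (D None (V m) z - (\<Sum>p\<in>UNIV. st_mixed_coeff g V p m z * V p z)))"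
    by (simp only: cov_X_Some[OF z] st_conn_time_time[OF z])
  also have "\<dots> = - (\<Sum>m\<in>UNIV. u l m z * Rt None (Some m) z)"
    unfolding Rt_sym[OF z, of None] Rt_spatial_time[OF z] sum_subtractf[symmetric] sum_negf[symmetric]
    by (intro sum.cong refl) (simp add: algebra_simps del: pd.simps)
  finally show ?thesis using Some by (simp add: ricci_up_Some)
qed

section \<open>The flow tensor \<open>B\<close> and its potential\<close>

abbreviation "B \<equiv> st_flow_bilinear T g V W"

lemma B_S: "B i j \<in> S"
proof -
  have "B i j = (\<lambda>z. Rt i j z - (1/2) * (D i (W j) z - (\<Sum>p\<in>UNIV. \<Gamma>t p i j z * W p z))
      - (1/2) * (D j (W i) z - (\<Sum>p\<in>UNIV. \<Gamma>t p j i z * W p z)))"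
    by (auto simp: st_flow_bilinear_def cov_form_def)
  moreover have "\<dots> \<in> S" by (intro st.S_intros Rt_S W_S st.\<Gamma>_S)
  ultimately show ?thesis by simp
qed

lemma B_sym: "z \<in> \<Omega> \<Longrightarrow> B i j z = B j i z"
  using Rt_sym[of z i j] by (simp add: st_flow_bilinear_def)

lemma B_spatial:
  assumes z: "z \<in> \<Omega>"
  shows "B (Some i) (Some j) z = - (1/2) * D None (g i j) z"
  unfolding flow[OF z]
  by (simp add: st_flow_bilinear_def Rt_spatial[OF z] cov_form_def sum_option W_Some field_simps)

definition \<psi> :: "'n field" where "\<psi> = (\<lambda>z. F z - W None z)"

lemma \<psi>_S: "\<psi> \<in> S"
  unfolding \<psi>_def by (intro st.S_intros F_S W_S)

lemma D_\<psi>: "z \<in> \<Omega> \<Longrightarrow> D i \<psi> z = D i F z - D i (W None) z"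
  unfolding \<psi>_def by (rule st.D_diff[OF F_S W_S])

text \<open>The \<open>of_bool\<close> terms are the symmetrized product of d\<psi> with dt, so they
  count twice when both indices are 0.\<close>

lemma B_eq:
  assumes z: "z \<in> \<Omega>"
  shows "B i j z = - (1/2) * (D None (G i j) z - of_bool (i = None) * D j \<psi> z
      - of_bool (j = None) * D i \<psi> z)"
proof -
  have mixed: "B None (Some l) z = - (1/2) * (D None (V l) z - D (Some l) \<psi> z)" for l
    unfolding st_flow_bilinear_def cov_W_time Rt_sym[OF z, of None] Rt_spatial_time[OF z] D_\<psi>[OF z]
    by (simp add: algebra_simps del: pd.simps)
  have time: "B None None z = - (1/2) * (D None F z - 2 * D None \<psi> z)"
  proof -
    have Rt_time: "Rt None None z
        = (1/2) * D None (scal g) z + (\<Sum>q\<in>UNIV. Rt None (Some q) z * raise u V q z)"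
      using z by (rule Rt_X) (rule cov_X_time)
    have "B None None z = Rt None None z - D None (W None) z + (\<Sum>k\<in>UNIV. \<Gamma>t (Some k) None None z * V k z)"
      by (simp add: st_flow_bilinear_def cov_form_def sum_option W_Some del: pd.simps st_conn.simps(5))
    also have "(\<Sum>k\<in>UNIV. \<Gamma>t (Some k) None None z * V k z)
        = (\<Sum>l\<in>UNIV. raise u V l z * (D None (V l) z - (1/2) * D (Some l) F z))"
      unfolding st_conn_time_time[OF z] raise_def sum_distrib_right
      by (subst sum.swap) (simp add: u_sym[OF z] mult_ac del: pd.simps)
    also have "Rt None None z = (1/2) * D None (scal g) z + (\<Sum>q\<in>UNIV. raise u V q z *
        ((1/2) * D (Some q) F z - (\<Sum>p\<in>UNIV. st_mixed_coeff g V p q z * V p z)))"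
      unfolding Rt_time Rt_sym[OF z, of None "Some _"] Rt_spatial_time[OF z]
      by (simp add: mult.commute del: pd.simps)
    \<comment> \<open>The gradients of \<open>F\<close> cancel, and what is left pairs the raised
      \<open>V\<close> with the covariant time derivative of \<open>V\<close>, which is half the
      time derivative of its squared norm.\<close>
    finally have "B None None z = (1/2) * D None (scal g) z - D None (W None) z
        + (\<Sum>q\<in>UNIV. raise u V q z * cov_form D \<Gamma>t W None (Some q) z)"
      unfolding cov_W_time by (simp add: right_diff_distrib sum_subtractf sum.distrib del: pd.simps)
    moreover have "D None F z = D None (scal g) z + 2 * (\<Sum>q\<in>UNIV. raise u V q z * cov_form D \<Gamma>t W None (Some q) z)"
    proof -
      have "F = (\<lambda>z. scal g z + (\<Sum>p\<in>UNIV. \<Sum>q\<in>UNIV. H p q z * W p z * W q z))"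
        by (auto simp: F_def norm_sq_def sum_option W_Some)
      then have "D None F z = D None (scal g) z
          + D None (\<lambda>z. \<Sum>p\<in>UNIV. \<Sum>q\<in>UNIV. H p q z * W p z * W q z) z"
        using z by (simp only: st.D_add scal_S st.S_intros st.H_S W_S)
      then show ?thesis
        unfolding st.D_norm_sq[where \<omega> = W, OF z W_S] sum_option[of "\<lambda>p. raise H W p z * _ p"] raise_H_W
        by simp
    qed
    ultimately show ?thesis by (simp add: D_\<psi>[OF z] algebra_simps del: pd.simps)
  qed
  show ?thesis
    using mixed time B_spatial[OF z] B_sym[OF z, of "Some _" None]
    by (cases i; cases j) (simp_all del: pd.simps)
qed

section \<open>The two evolution equations in one chart\<close>

abbreviation "Am \<equiv> st_flow_mixed T g V W"

lemma D_st_metric: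
  assumes z: "z \<in> \<Omega>"
  shows "D None (H i j) z = (\<Sum>k\<in>UNIV. \<Sum>l\<in>UNIV. H i k z * H j l z *
      (2 * Rt k l z - cov_form D \<Gamma>t W k l z - cov_form D \<Gamma>t W l k z))"
proof -
  have B: "2 * Rt k l z - cov_form D \<Gamma>t W k l z - cov_form D \<Gamma>t W l k z = 2 * B k l z" for k l
    by (simp add: st_flow_bilinear_def)
  show ?thesis
  proof (cases i; cases j)
    fix a b assume "i = Some a" "j = Some b"
    then show ?thesis unfolding B
      using B_spatial[OF z] D_u[OF z, of None a b] by (simp add: sum_option sum_negf del: pd.simps)
  qed (simp_all add: st.D_const[OF z] del: pd.simps)
qed

lemma Am_eq:
  assumes z: "z \<in> \<Omega>"
  shows "Am k j z = raise H (B j) k z"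
  unfolding st_flow_mixed_def st.cov_vector_raise[where \<omega> = W, OF z W_S]
  by (simp add: raise_def st_flow_bilinear_def right_diff_distrib sum_subtractf sum_distrib_left mult_ac)

text \<open>Differentiate \<open>st_conn_eq\<close> in time. The derivative of \<open>L\<close>
  matches the plain derivatives of \<open>B\<close>, and the derivative of \<open>u\<close> matches
  the connection term left by \<open>cov_bilinear_christoffel\<close>.\<close>

lemma D_st_conn:
  assumes z: "z \<in> \<Omega>"
  shows "D None (\<Gamma>t k i j) z = - cov_mixed D \<Gamma>t Am i k j z - cov_mixed D \<Gamma>t Am j k i z
    + raise H (\<lambda>l. cov_bilinear D \<Gamma>t B l i j) k z"
proof -
  let ?E = "\<lambda>l z. - cov_bilinear D \<Gamma>t B i j l z - cov_bilinear D \<Gamma>t B j i l z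
      + cov_bilinear D \<Gamma>t B l i j z"
  have cov: "cov_mixed D \<Gamma>t Am i k j z = raise H (\<lambda>l. cov_bilinear D \<Gamma>t B i j l) k z" for i j
    using z B_S Am_eq by (rule st.cov_mixed_raise)
  have rhs: "- cov_mixed D \<Gamma>t Am i k j z - cov_mixed D \<Gamma>t Am j k i z
      + raise H (\<lambda>l. cov_bilinear D \<Gamma>t B l i j) k z = raise H ?E k z"
    unfolding cov
    by (simp add: raise_def distrib_left right_diff_distrib sum.distrib sum_subtractf sum_negf)
  show ?thesis
  proof (cases k)
    case None
    then show ?thesis unfolding rhs by (simp add: raise_H st.D_const[OF z] del: pd.simps)
  next
    case (Some m)
    have E: "?E (Some l) z = D None (L l i j) z - (\<Sum>p\<in>UNIV. \<Gamma>t (Some p) i j z * D None (g p l) z)" for l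
    proof -
      have DB: "D a (B b c) z = - (1/2) * (D a (D None (G b c)) z - of_bool (b = None) * D a (D c \<psi>) z
          - of_bool (c = None) * D a (D b \<psi>) z)" for a b c
      proof -
        have "D a (B b c) z = D a (\<lambda>z. - (1/2) * (D None (G b c) z - of_bool (b = None) * D c \<psi> z
          - of_bool (c = None) * D b \<psi> z)) z"
          by (rule st.D_cong[OF z]) (rule B_eq)
        then show ?thesis
          using z by (simp only: st.D_rules st.S_intros G_S \<psi>_S mult_zero_left add_0_right)
      qed
      have DL: "D None (L l i j) z = (1/2) * (D None (D i (G j (Some l))) z + D None (D j (G i (Some l))) z
          - D None (D (Some l) (G i j)) z)"
      proof -
        have "L l i j = (\<lambda>z. (1/2) * (D i (G j (Some l)) z + D j (G i (Some l)) z - D (Some l) (G i j) z))"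
          by (auto simp: L_def)
        then show ?thesis
          using z by (simp only: st.D_rules st.S_intros G_S mult_zero_left add_0_right)
      qed
      have "?E (Some l) z = - D i (B j (Some l)) z - D j (B i (Some l)) z + D (Some l) (B i j) z
          + 2 * (\<Sum>p\<in>UNIV. \<Gamma>t p i j z * B p (Some l) z)"
        using z B_sym[OF z] by (rule st.cov_bilinear_christoffel)
      \<comment> \<open>The time summand vanishes with the upper time index of the connection, and
        \<open>l\<close> is spatial, so only \<open>B_spatial\<close> is involved.\<close>
      also have "2 * (\<Sum>p\<in>UNIV. \<Gamma>t p i j z * B p (Some l) z)
          = - (\<Sum>p\<in>UNIV. \<Gamma>t (Some p) i j z * D None (g p l) z)"
        by (simp add: sum_option B_spatial[OF z] sum_negf sum_divide_distrib[symmetric] del: pd.simps)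
      \<comment> \<open>Because \<open>l\<close> is spatial, each second derivative of \<psi> occurs
        twice with opposite signs, up to the order of differentiation.\<close>
      also have "- D i (B j (Some l)) z - D j (B i (Some l)) z + D (Some l) (B i j) z = D None (L l i j) z"
        unfolding DB DL st.D_commute[OF G_S z, of _ None]
        using st.D_commute[OF \<psi>_S z, of i "Some l"] st.D_commute[OF \<psi>_S z, of j "Some l"]
        by (simp add: field_simps del: pd.simps)
      finally show ?thesis by simp
    qed
    have "D None (\<Gamma>t (Some m) i j) z = D None (\<lambda>z. \<Sum>l\<in>UNIV. u m l z * L l i j z) z"
      by (rule st.D_cong[OF z]) (rule st_conn_eq)
    also have "\<dots> = (\<Sum>l\<in>UNIV. u m l z * D None (L l i j) z) + (\<Sum>l\<in>UNIV. D None (u m l) z * L l i j z)"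
      using z by (simp add: st.D_rules st.S_intros u_S L_S sum.distrib del: pd.simps)
    also have "(\<Sum>l\<in>UNIV. D None (u m l) z * L l i j z)
        = - (\<Sum>l\<in>UNIV. u m l z * (\<Sum>p\<in>UNIV. \<Gamma>t (Some p) i j z * D None (g p l) z))"
    proof -
      have gs: "D None (g a b) z = D None (g b a) z" for a b
        by (rule st.D_cong[OF z]) (rule g_sym)
      have "(\<Sum>l\<in>UNIV. D None (u m l) z * L l i j z)
          = - (\<Sum>a\<in>UNIV. u m a z * (\<Sum>l\<in>UNIV. \<Sum>p\<in>UNIV. u p l z * L l i j z * D None (g p a) z))"
      proof -
        have "(\<Sum>l\<in>UNIV. D None (u m l) z * L l i j z)
            = - (\<Sum>l\<in>UNIV. \<Sum>a\<in>UNIV. u m a z * (\<Sum>p\<in>UNIV. u p l z * L l i j z * D None (g p a) z))"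
          unfolding D_u[OF z]
          by (simp add: sum_negf sum_distrib_left sum_distrib_right gs u_sym[OF z] mult_ac del: pd.simps)
        then show ?thesis unfolding sum_distrib_left by (subst (asm) (2) sum.swap)
      qed
      moreover have "(\<Sum>l\<in>UNIV. \<Sum>p\<in>UNIV. u p l z * L l i j z * D None (g p a) z)
          = (\<Sum>p\<in>UNIV. \<Gamma>t (Some p) i j z * D None (g p a) z)" for a
        unfolding st_conn_eq[OF z] sum_distrib_right by (rule sum.swap)
      ultimately show ?thesis by (simp only:)
    qed
    finally show ?thesis
      unfolding rhs using Some E
      by (simp add: raise_H right_diff_distrib sum_subtractf del: pd.simps)
  qed
qed

end

section \<open>From one chart to the whole atlas\<close>

theorem theorem3p1:
  fixes M :: "'m topology"
    and A :: "('m, 'n::finite) chart set"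
    and T :: ereal
    and g :: "('m, 'n) chart \<Rightarrow> 'n \<Rightarrow> 'n \<Rightarrow> 'n field"
    and V :: "('m, 'n) chart \<Rightarrow> 'n \<Rightarrow> 'n field"
    and \<eta> :: "'m \<times> real \<Rightarrow> real"
  assumes "smooth_manifold M A"
    and "0 < T"
    and "smooth_form_family A T V"
    and "smooth_metric_family A T g"
    and "modified_ricci_flow A T g V"
    and "smooth_function_on_spacetime A T \<eta>"
  shows "\<forall>c\<in>A. \<forall>x\<in>chart_image c. \<forall>t\<in>time_dom T.
    (let gt = st_metric (g c);
         \<Gamma>t = st_conn T (g c) (V c);
         Rt = st_Ric T (g c) (V c);
         Vt = st_form c \<eta> (V c);
         Am = st_flow_mixed T (g c) (V c) Vt;
         Bm = st_flow_bilinear T (g c) (V c) Vt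
     in (\<forall>i j. ((\<lambda>s. gt i j (x, s)) has_real_derivative
           (\<Sum>k\<in>UNIV. \<Sum>l\<in>UNIV. gt i k (x, t) * gt j l (x, t) *
              (2 * Rt k l (x, t) - cov_form (pd T) \<Gamma>t Vt k l (x, t)
                 - cov_form (pd T) \<Gamma>t Vt l k (x, t)))) (at t within time_dom T)) \<and>
        (\<forall>i j k. ((\<lambda>s. \<Gamma>t k i j (x, s)) has_real_derivative
           - cov_mixed (pd T) \<Gamma>t Am i k j (x, t)
           - cov_mixed (pd T) \<Gamma>t Am j k i (x, t)
           + raise gt (\<lambda>l. cov_bilinear (pd T) \<Gamma>t Bm l i j) k (x, t)) (at t within time_dom T)))"
proof (intro ballI)
  fix c x t
  assume c: "c \<in> A" and x: "x \<in> chart_image c" and t: "t \<in> time_dom T"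
  have "open (chart_image c)"
    using assms(1) c by (auto simp: smooth_manifold_def is_chart_def)
  then interpret st_domain "chart_image c" T by unfold_locales
  interpret modified_flow "chart_image c" T "g c" "V c" "st_form c \<eta> (V c)"
  proof unfold_locales
    fix i j k z and v :: "real ^ 'n"
    show "g c i j \<in> S"
      using assms(4) c by (simp add: smooth_metric_family_def S_def \<Omega>_def)
    show "st_form c \<eta> (V c) k \<in> S"
      using assms(3,6) c
      by (cases k) (simp_all add: smooth_form_family_def smooth_function_on_spacetime_def S_def \<Omega>_def)
    show "st_form c \<eta> (V c) (Some i) = V c i" by simp
    assume z: "z \<in> \<Omega>"
    show "g c i j z = g c j i z"
      using assms(4) c z by (auto simp: smooth_metric_family_def \<Omega>_def)
    show "(\<Sum>i\<in>UNIV. \<Sum>j\<in>UNIV. g c i j z * v $ i * v $ j) > 0" if "v \<noteq> 0"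
      using assms(4) c z that by (auto simp: smooth_metric_family_def \<Omega>_def)
    obtain y s where y: "z = (y, s)" "y \<in> chart_image c" "s \<in> time_dom T"
      using z by (auto simp: \<Omega>_def)
    show "pd T None (g c i j) z = - 2 * Ric (g c) i j z
        + cov_form spatial_pd (christoffel (g c)) (V c) i j z
        + cov_form spatial_pd (christoffel (g c)) (V c) j i z"
      \<comment> \<open>Nontriviality of the filter turns the assumed time derivative into the value
        of \<open>pd T None\<close>.\<close>
      using assms(5) c y at_within_time_dom_neq_bot[OF y(3)]
      by (auto simp: modified_ricci_flow_def has_real_derivative_iff_has_vector_derivative
          intro!: vector_derivative_within)
  qed
  have z: "(x, t) \<in> \<Omega>" using x t by (simp add: \<Omega>_def)
  show "let gt = st_metric (g c);
         \<Gamma>t = st_conn T (g c) (V c);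
         Rt = st_Ric T (g c) (V c);
         Vt = st_form c \<eta> (V c);
         Am = st_flow_mixed T (g c) (V c) Vt;
         Bm = st_flow_bilinear T (g c) (V c) Vt
     in (\<forall>i j. ((\<lambda>s. gt i j (x, s)) has_real_derivative
           (\<Sum>k\<in>UNIV. \<Sum>l\<in>UNIV. gt i k (x, t) * gt j l (x, t) *
              (2 * Rt k l (x, t) - cov_form (pd T) \<Gamma>t Vt k l (x, t)
                 - cov_form (pd T) \<Gamma>t Vt l k (x, t)))) (at t within time_dom T)) \<and>
        (\<forall>i j k. ((\<lambda>s. \<Gamma>t k i j (x, s)) has_real_derivative
           - cov_mixed (pd T) \<Gamma>t Am i k j (x, t)
           - cov_mixed (pd T) \<Gamma>t Am j k i (x, t)
           + raise gt (\<lambda>l. cov_bilinear (pd T) \<Gamma>t Bm l i j) k (x, t)) (at t within time_dom T))"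
    \<comment> \<open>Both right-hand sides become values of \<open>pd T None\<close>, and
      differentiability follows from smoothness of the components.\<close>
    unfolding Let_def D_st_metric[OF z, symmetric] D_st_conn[OF z, symmetric]
    by (intro conjI allI has_real_derivative_pd_None st.H_S st.\<Gamma>_S x t)
qed

end
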